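(* Let $(\Omega,\mathscr{F},\mathbf{P})$ be a complete probability space and let $X$ be a $\mathscr{B}_{(0,T)}\otimes\mathscr{F}$-measurable stochastic process on it, with $\mathscr{F}=\sigma\{X\}$. Let $\mathfrak{A}=(\mathscr{A}^t)_{t\in(0,T)}$ be a collection of sub-$\sigma$-fields of $\mathscr{F}$ which is regular for $X$ and which $\mathrm{L}^1$-differentiates $X$. Then there exists a measurable version of the differentiated process $D^{\mathfrak{A}}X=(D^{\mathscr{A}^t}X_t)_{t\in(0,T)}$, i.e. a $\mathscr{B}_{(0,T)}\otimes\mathscr{F}$-measurable process $Y$ such that, for all $t\in(0,T)$, $Y_t=D^{\mathscr{A}^t}X_t$ a.s. This version is also adapted to the filtration $(\mathscr{A}_t)_{t\in(0,T)}$ generated by $\mathfrak{A}$, where $\mathscr{A}_t=\bigvee_{0<s\le t}\mathscr{A}^s$.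
   Context: $\mathscr{B}_{(0,T)}$ is the Borel $\sigma$-field of $(0,T)$. The process $X$ takes values in $\mathbb{R}^d$ ($d\ge1$) and is square integrable: $X_t\in\mathrm{L}^2(\mathbf{P})$ for every $t$. For $t\in(0,T)$ and $h\ne0$ with $t+h\in(0,T)$, set $\Delta_hX_t=(X_{t+h}-X_t)/h$. A sub-$\sigma$-field $\mathscr{G}$ of $\mathscr{F}$ $\mathrm{L}^1$-differentiates $X$ at $t$ if $\mathrm{E}[\Delta_hX_t\mid\mathscr{G}]$ converges in $\mathrm{L}^1(\mathbf{P})$ as $h\to0$; the limit is the stochastic derivative $D^{\mathscr{G}}X_t$. The collection $(\mathscr{A}^t)_{t\in(0,T)}$ $\mathrm{L}^1$-differentiates $X$ if, for every $t\in(0,T)$, $\mathscr{A}^t$ $\mathrm{L}^1$-differentiates $X$ at $t$. The collection $\mathfrak{A}=(\mathscr{A}^t)_t$ is regular for $X$ if, for all $n\in\mathbb{N}$, all times $t_1,\ldots,t_n\in[0,T]$ and all $\phi_1,\ldots,\phi_n\in C_0^\infty(\mathbb{R}^d)$, the process $t\mapsto\mathrm{E}[\phi_1(X_{t_1})\cdots\phi_n(X_{t_n})\mid\mathscr{A}^t]$ has a (jointly) measurable version. *)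

theory Defs
  imports "HOL-Probability.Probability"
begin

text \<open>
  A process on \<open>[0,T]\<close> is a function \<open>X :: real \<Rightarrow> 'w \<Rightarrow> real^'d\<close> of which only the values at
  times in \<open>{0..T}\<close> matter. A sub-\<open>\<sigma>\<close>-field is a measure \<open>G\<close> with \<open>subalgebra M G\<close>; only its
  space and its sets matter.
\<close>

definition square_integrable_process ::
    "'w measure \<Rightarrow> real \<Rightarrow> (real \<Rightarrow> 'w \<Rightarrow> real^'d) \<Rightarrow> bool" where
  "square_integrable_process M T X \<longleftrightarrow>
     (\<forall>t\<in>{0..T}. X t \<in> borel_measurable M \<and> integrable M (\<lambda>\<omega>. (norm (X t \<omega>))\<^sup>2))"

definition measurable_process ::
    "'w measure \<Rightarrow> real \<Rightarrow> (real \<Rightarrow> 'w \<Rightarrow> 'b::topological_space) \<Rightarrow> bool" where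
  "measurable_process M T Y \<longleftrightarrow>
     (\<lambda>(t, \<omega>). Y t \<omega>) \<in> borel_measurable (restrict_space borel {0<..<T} \<Otimes>\<^sub>M M)"

text \<open>
  Since the probability space is complete, the \<open>\<sigma>\<close>-field generated by \<open>X\<close> is taken to contain
  the null sets. If the uncompleted \<open>\<sigma>\<close>-field already exhausts \<open>sets M\<close>, then so does this one.
\<close>

definition process_sigma_field ::
    "'w measure \<Rightarrow> real \<Rightarrow> (real \<Rightarrow> 'w \<Rightarrow> real^'d) \<Rightarrow> 'w set set" where
  "process_sigma_field M T X =
     sigma_sets (space M)
       ({X t -` B \<inter> space M | t B. t \<in> {0..T} \<and> B \<in> sets borel} \<union> null_sets M)"

text \<open>The conditional expectation of the library is real-valued; it is applied componentwise.\<close>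

definition vec_cond_exp ::
    "'w measure \<Rightarrow> 'w measure \<Rightarrow> ('w \<Rightarrow> real^'d) \<Rightarrow> 'w \<Rightarrow> real^'d" where
  "vec_cond_exp M G f = (\<lambda>\<omega>. \<chi> i. real_cond_exp M G (\<lambda>\<omega>'. f \<omega>' $ i) \<omega>)"

definition diff_quot :: "(real \<Rightarrow> 'w \<Rightarrow> real^'d) \<Rightarrow> real \<Rightarrow> real \<Rightarrow> 'w \<Rightarrow> real^'d" where
  "diff_quot X h t = (\<lambda>\<omega>. (X (t + h) \<omega> - X t \<omega>) /\<^sub>R h)"

text \<open>The filter \<open>at 0 within _\<close> restricts to those \<open>h \<noteq> 0\<close> for which \<open>t + h\<close> lies in \<open>(0,T)\<close>.\<close>

definition has_stoch_deriv ::
    "'w measure \<Rightarrow> real \<Rightarrow> 'w measure \<Rightarrow> (real \<Rightarrow> 'w \<Rightarrow> real^'d) \<Rightarrow> real \<Rightarrow> ('w \<Rightarrow> real^'d) \<Rightarrow> bool" where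
  "has_stoch_deriv M T G X t Z \<longleftrightarrow>
     integrable M Z \<and>
     ((\<lambda>h. \<integral>\<^sup>+ \<omega>. norm (vec_cond_exp M G (diff_quot X h t) \<omega> - Z \<omega>) \<partial>M) \<longlongrightarrow> 0)
       (at 0 within {h. t + h \<in> {0<..<T}})"

definition L1_differentiates_at ::
    "'w measure \<Rightarrow> real \<Rightarrow> 'w measure \<Rightarrow> (real \<Rightarrow> 'w \<Rightarrow> real^'d) \<Rightarrow> real \<Rightarrow> bool" where
  "L1_differentiates_at M T G X t \<longleftrightarrow> (\<exists>Z. has_stoch_deriv M T G X t Z)"

text \<open>A representative of the \<open>L\<^sup>1\<close>-limit, which is determined only almost surely.\<close>

definition stoch_deriv ::
    "'w measure \<Rightarrow> real \<Rightarrow> 'w measure \<Rightarrow> (real \<Rightarrow> 'w \<Rightarrow> real^'d) \<Rightarrow> real \<Rightarrow> 'w \<Rightarrow> real^'d" where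
  "stoch_deriv M T G X t = (SOME Z. has_stoch_deriv M T G X t Z)"

definition L1_differentiates ::
    "'w measure \<Rightarrow> real \<Rightarrow> (real \<Rightarrow> 'w measure) \<Rightarrow> (real \<Rightarrow> 'w \<Rightarrow> real^'d) \<Rightarrow> bool" where
  "L1_differentiates M T \<A> X \<longleftrightarrow> (\<forall>t\<in>{0<..<T}. L1_differentiates_at M T (\<A> t) X t)"

primrec k_times_cont_differentiable :: "nat \<Rightarrow> (real^'d \<Rightarrow> real) \<Rightarrow> bool" where
  "k_times_cont_differentiable 0 f \<longleftrightarrow> continuous_on UNIV f"
| "k_times_cont_differentiable (Suc k) f \<longleftrightarrow>
     (\<forall>x. f differentiable (at x)) \<and>
     (\<forall>v. k_times_cont_differentiable k (\<lambda>x. frechet_derivative f (at x) v))"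

definition test_function :: "(real^'d \<Rightarrow> real) \<Rightarrow> bool" where
  "test_function \<phi> \<longleftrightarrow>
     (\<forall>k. k_times_cont_differentiable k \<phi>) \<and> compact (closure {x. \<phi> x \<noteq> 0})"

definition regular_for ::
    "'w measure \<Rightarrow> real \<Rightarrow> (real \<Rightarrow> 'w measure) \<Rightarrow> (real \<Rightarrow> 'w \<Rightarrow> real^'d) \<Rightarrow> bool" where
  "regular_for M T \<A> X \<longleftrightarrow>
     (\<forall>(n::nat) (\<tau> :: nat \<Rightarrow> real) (\<phi> :: nat \<Rightarrow> real^'d \<Rightarrow> real).
        (\<forall>i\<in>{1..n}. \<tau> i \<in> {0..T} \<and> test_function (\<phi> i)) \<longrightarrow>
        (\<exists>V :: real \<Rightarrow> 'w \<Rightarrow> real. measurable_process M T V \<and>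
           (\<forall>t\<in>{0<..<T}. AE \<omega> in M.
              V t \<omega> = real_cond_exp M (\<A> t) (\<lambda>\<omega>'. \<Prod>i=1..n. \<phi> i (X (\<tau> i) \<omega>')) \<omega>)))"

definition generated_filtration ::
    "'w measure \<Rightarrow> (real \<Rightarrow> 'w measure) \<Rightarrow> real \<Rightarrow> 'w measure" where
  "generated_filtration M \<A> t = sigma (space M) (\<Union>s\<in>{0<..t}. sets (\<A> s))"

end

theory Submission
  imports Defs
begin

text \<open>
  Call a family \<open>Z\<close> in \<open>L\<^sup>1(M)\<close> indexed by \<open>(0,T)\<close> strongly measurable if it is uniformly approximated by
  Borel maps with countably many values. Regularity, a \<open>\<pi>\<close>-\<open>\<lambda>\<close> argument and the \<open>L\<^sup>1\<close>-contraction
  property make \<open>t \<mapsto> E[F | \<A>\<^sup>t]\<close> strongly measurable for each integrable \<open>F\<close>, then also for a strongly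
  measurable \<open>F = F\<^sub>t\<close>, in particular for the difference quotients of \<open>X\<close>; strong measurability passes
  to pointwise limits, hence to the derivative. If \<open>Z\<close> is strongly measurable, there are
  countably-valued Borel times \<open>\<sigma>\<^sub>n(t) \<le> t\<close> with \<open>\<parallel>Z(\<sigma>\<^sub>n(t)) - Z(t)\<parallel>\<^sub>1 < 2\<^sup>-\<^sup>n\<close>. Since \<open>\<sigma>\<^sub>n(t) \<le> t\<close>, the
  limit of \<open>Z(\<sigma>\<^sub>n(t))\<close> is a jointly measurable version that is adapted without augmenting the
  filtration by null sets.
\<close>

subsection \<open>Test functions\<close>

text \<open>The definition refers to \<open>frechet_derivative\<close>, a chosen derivative. By
  uniqueness any explicit derivative may take its place, so the inductions below can use the usual
  differentiation rules.\<close>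

lemma k_times_cont_differentiable_Suc:
  assumes "\<And>x. (f has_derivative f' x) (at x)"
    and "\<And>v. k_times_cont_differentiable k (\<lambda>x. f' x v)"
  shows "k_times_cont_differentiable (Suc k) f"
proof -
  have "frechet_derivative f (at x) = f' x" for x
    using frechet_derivative_at[OF assms(1)] by simp
  then show ?thesis
    using assms by (auto simp: differentiable_def)
qed

lemma k_times_cont_differentiable_SucD:
  assumes "k_times_cont_differentiable (Suc k) f"
  shows "(f has_derivative frechet_derivative f (at x)) (at x)"
    and "k_times_cont_differentiable k (\<lambda>x. frechet_derivative f (at x) v)"
  using assms by (auto simp: frechet_derivative_works)

lemma k_times_cont_differentiable_lower:
  "k_times_cont_differentiable (Suc k) f \<Longrightarrow> k_times_cont_differentiable k f"
proof (induction k arbitrary: f)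
  case 0
  then show ?case
    by (auto intro!: differentiable_imp_continuous_on simp: differentiable_on_def
        intro: differentiable_at_withinI)
qed auto

lemma k_times_cont_differentiable_const: "k_times_cont_differentiable k (\<lambda>x. c)"
proof (induction k arbitrary: c)
  case (Suc k)
  then show ?case
    by (intro k_times_cont_differentiable_Suc[where f' = "\<lambda>_ _. 0"]) auto
qed simp

lemma k_times_cont_differentiable_add:
  "k_times_cont_differentiable k f \<Longrightarrow> k_times_cont_differentiable k g \<Longrightarrow>
    k_times_cont_differentiable k (\<lambda>x. f x + g x)"
proof (induction k arbitrary: f g)
  case 0
  then show ?case by (simp add: continuous_on_add)
next
  case (Suc k)
  show ?case
    by (rule k_times_cont_differentiable_Suc[OF has_derivative_add[OF
          k_times_cont_differentiable_SucD(1)[OF Suc.prems(1)]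
          k_times_cont_differentiable_SucD(1)[OF Suc.prems(2)]]])
      (intro Suc.IH k_times_cont_differentiable_SucD(2) Suc.prems)
qed

lemma k_times_cont_differentiable_mult:
  "k_times_cont_differentiable k f \<Longrightarrow> k_times_cont_differentiable k g \<Longrightarrow>
    k_times_cont_differentiable k (\<lambda>x. f x * g x)"
proof (induction k arbitrary: f g)
  case 0
  then show ?case by (simp add: continuous_on_mult)
next
  case (Suc k)
  show ?case
  proof (rule k_times_cont_differentiable_Suc[OF has_derivative_mult[OF
          k_times_cont_differentiable_SucD(1)[OF Suc.prems(1)]
          k_times_cont_differentiable_SucD(1)[OF Suc.prems(2)]]])
    show "k_times_cont_differentiable k
        (\<lambda>x. f x * frechet_derivative g (at x) v + frechet_derivative f (at x) v * g x)" for v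
      using Suc.prems by (intro k_times_cont_differentiable_add Suc.IH
          k_times_cont_differentiable_lower[of k f] k_times_cont_differentiable_lower[of k g]
          k_times_cont_differentiable_SucD(2))
  qed
qed

lemma k_times_cont_differentiable_power:
  "k_times_cont_differentiable k f \<Longrightarrow> k_times_cont_differentiable k (\<lambda>x. f x ^ n)"
  by (induction n)
    (auto intro: k_times_cont_differentiable_const k_times_cont_differentiable_mult)

lemma k_times_cont_differentiable_prod:
  "(\<And>i. i \<in> I \<Longrightarrow> k_times_cont_differentiable k (f i)) \<Longrightarrow>
    k_times_cont_differentiable k (\<lambda>x. \<Prod>i\<in>I. f i x)"
  by (induction I rule: infinite_finite_induct)
    (auto intro: k_times_cont_differentiable_const k_times_cont_differentiable_mult)

section \<open>Smooth functions that are positive exactly on an open box\<close>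

definition poly_exp_inverse :: "real poly \<Rightarrow> real \<Rightarrow> real" where
  "poly_exp_inverse p x = (if x > 0 then poly p (inverse x) * exp (- inverse x) else 0)"

lemma poly_div_exp_tendsto_0: "((\<lambda>y. poly p y * exp (- y)) \<longlongrightarrow> (0::real)) at_top"
proof -
  have "((\<lambda>y. \<Sum>i\<le>degree p. coeff p i * (y ^ i / exp y)) \<longlongrightarrow> (\<Sum>i\<le>degree p. coeff p i * 0)) at_top"
    by (intro tendsto_intros tendsto_power_div_exp_0)
  then show ?thesis
    by (simp add: poly_altdef exp_minus field_simps sum_distrib_left sum_divide_distrib)
qed

text \<open>With \<open>y = inverse x\<close>, differentiating \<open>p(y) exp (- y)\<close> gives
  \<open>y\<^sup>2 (p(y) - p'(y)) exp (- y)\<close>, which is again of the same form. The family is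
  thus closed under differentiation, and \<open>p = 1\<close> gives the classical function that is
  flat at 0.\<close>

lemma poly_exp_inverse_has_derivative:
  "(poly_exp_inverse p has_field_derivative
      poly_exp_inverse ([:0, 0, 1:] * (p - pderiv p)) x) (at x)"
proof -
  consider "x > 0" | "x < 0" | "x = 0" by linarith
  then show ?thesis
  proof cases
    case 1
    have "((\<lambda>x. poly p (inverse x) * exp (- inverse x)) has_field_derivative
        poly_exp_inverse ([:0, 0, 1:] * (p - pderiv p)) x) (at x)"
      using 1 by (auto intro!: derivative_eq_intros simp: poly_exp_inverse_def field_simps power2_eq_square)
    moreover have "\<forall>\<^sub>F y in nhds x. poly_exp_inverse p y = poly p (inverse y) * exp (- inverse y)"
      using eventually_nhds_in_open[of "{0<..}" x] 1
      by (auto simp: poly_exp_inverse_def elim!: eventually_mono)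
    ultimately show ?thesis
      by (simp only: DERIV_cong_ev[OF refl _ refl])
  next
    case 2
    have "((\<lambda>x. 0) has_field_derivative
        poly_exp_inverse ([:0, 0, 1:] * (p - pderiv p)) x) (at x)"
      using 2 by (simp add: poly_exp_inverse_def)
    moreover have "\<forall>\<^sub>F y in nhds x. poly_exp_inverse p y = 0"
      using eventually_nhds_in_open[of "{..<0}" x] 2
      by (auto simp: poly_exp_inverse_def elim!: eventually_mono)
    ultimately show ?thesis
      by (simp only: DERIV_cong_ev[OF refl _ refl])
  next
    case 3
    \<comment> \<open>Dividing by the argument multiplies the polynomial in \<open>inverse y\<close>
      by its variable, hence \<open>pCons 0 p\<close>.\<close>
    have "((\<lambda>y. poly (pCons 0 p) (inverse y) * exp (- inverse y)) \<longlongrightarrow> (0::real)) (at_right 0)"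
      by (rule filterlim_compose[OF poly_div_exp_tendsto_0 filterlim_inverse_at_top_right])
    then have "((\<lambda>y. poly_exp_inverse p y / y) \<longlongrightarrow> 0) (at_right 0)"
      by (rule Lim_transform_eventually)
        (auto simp: eventually_at_right_field poly_exp_inverse_def field_simps intro!: exI[of _ 1])
    moreover have "((\<lambda>y. poly_exp_inverse p y / y) \<longlongrightarrow> 0) (at_left 0)"
      by (rule Lim_transform_eventually[OF tendsto_const])
        (auto simp: eventually_at_left_field poly_exp_inverse_def intro!: exI[of _ "-1"])
    ultimately have "((\<lambda>y. poly_exp_inverse p y / y) \<longlongrightarrow> 0) (at 0)"
      by (simp add: filterlim_at_split)
    then show ?thesis
      using 3 by (simp add: has_field_derivative_iff poly_exp_inverse_def)
  qed
qed

text \<open>The polynomial has to be arbitrary in the induction because each derivative changes it.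
  The factor \<open>c\<close> admits both signs, as needed for the two faces of a box in direction
  \<open>i\<close>.\<close>

lemma k_times_cont_differentiable_poly_exp_inverse:
  "k_times_cont_differentiable k (\<lambda>x::real^'d. poly_exp_inverse p (c * x $ i + d))"
proof (induction k arbitrary: p)
  case 0
  have "continuous_on UNIV (poly_exp_inverse p)"
    using DERIV_isCont[OF poly_exp_inverse_has_derivative[of p]]
    by (simp add: continuous_on_eq_continuous_at)
  then have "continuous_on UNIV (poly_exp_inverse p \<circ> (\<lambda>x::real^'d. c * x $ i + d))"
    by (rule continuous_on_compose[rotated, OF continuous_on_subset])
      (auto intro!: continuous_on_add continuous_on_mult continuous_on_const
        linear_continuous_on[OF bounded_linear_vec_nth])
  then show ?case by (simp add: o_def)
next
  case (Suc k)
  let ?q = "[:0, 0, 1:] * (p - pderiv p)"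
  show ?case
  proof (rule k_times_cont_differentiable_Suc)
    fix x :: "real^'d"
    have "((\<lambda>x::real^'d. c * x $ i + d) has_derivative (\<lambda>v. c * v $ i)) (at x)"
      by (intro has_derivative_add_const has_derivative_mult_right
          bounded_linear_imp_has_derivative bounded_linear_vec_nth)
    from has_derivative_compose[OF this
        poly_exp_inverse_has_derivative[unfolded has_field_derivative_def]]
    show "((\<lambda>x. poly_exp_inverse p (c * x $ i + d)) has_derivative
        (\<lambda>v. poly_exp_inverse ?q (c * x $ i + d) * (c * v $ i))) (at x)" .
  next
    show "k_times_cont_differentiable k
        (\<lambda>x. poly_exp_inverse ?q (c * x $ i + d) * (c * v $ i))" for v :: "real^'d"
      by (intro k_times_cont_differentiable_mult Suc k_times_cont_differentiable_const)
  qed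
qed

definition box_bump :: "real^'d \<Rightarrow> real^'d \<Rightarrow> real^'d \<Rightarrow> real" where
  "box_bump a b x = (\<Prod>i\<in>UNIV. poly_exp_inverse 1 (x $ i - a $ i) * poly_exp_inverse 1 (b $ i - x $ i))"

lemma k_times_cont_differentiable_box_bump:
  fixes a b :: "real^'d"
  shows "k_times_cont_differentiable k (box_bump a b)"
proof -
  have "k_times_cont_differentiable k (\<lambda>x::real^'d. poly_exp_inverse 1 (x $ i - a $ i))"
    "k_times_cont_differentiable k (\<lambda>x::real^'d. poly_exp_inverse 1 (b $ i - x $ i))" for i
    using k_times_cont_differentiable_poly_exp_inverse[of k 1 1 i "- a $ i"]
      k_times_cont_differentiable_poly_exp_inverse[of k 1 "-1" i "b $ i"] by simp_all
  then show ?thesis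
    unfolding box_bump_def
    by (intro k_times_cont_differentiable_prod k_times_cont_differentiable_mult)
qed

lemma poly_exp_inverse_1: "0 \<le> poly_exp_inverse 1 x" "poly_exp_inverse 1 x \<le> 1"
  "poly_exp_inverse 1 x = 0 \<longleftrightarrow> x \<le> 0"
  by (auto simp: poly_exp_inverse_def)

lemma box_bump_bounds: "0 \<le> box_bump a b x" "box_bump a b x \<le> 1"
  unfolding box_bump_def
  by (auto intro!: prod_nonneg prod_le_1 mult_nonneg_nonneg mult_le_one poly_exp_inverse_1)

lemma box_bump_eq_0_iff: "box_bump a b x = 0 \<longleftrightarrow> x \<notin> box a b"
  unfolding box_bump_def mem_box_cart by (auto simp: poly_exp_inverse_1 not_less)

text \<open>A polynomial in the bump without constant term: smoothness is inherited, it still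
  vanishes off the box, and as \<open>m\<close> grows it tends to 1 inside.\<close>

definition box_approx :: "nat \<Rightarrow> real^'d \<Rightarrow> real^'d \<Rightarrow> real^'d \<Rightarrow> real" where
  "box_approx m a b x = 1 - (1 - box_bump a b x) ^ m"

lemma test_function_box_approx: "test_function (box_approx m a b)"
proof -
  have "k_times_cont_differentiable k (\<lambda>x. 1 + (-1) * (1 + (-1) * box_bump a b x) ^ m)" for k
    by (intro k_times_cont_differentiable_add k_times_cont_differentiable_mult
        k_times_cont_differentiable_power k_times_cont_differentiable_const
        k_times_cont_differentiable_box_bump)
  moreover have "compact (closure {x. box_approx m a b x \<noteq> 0})"
  proof -
    have "{x. box_approx m a b x \<noteq> 0} \<subseteq> box a b"
      using box_bump_eq_0_iff[of a b] by (force simp: box_approx_def)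
    then show ?thesis
      by (meson bounded_box bounded_subset compact_closure)
  qed
  ultimately show ?thesis
    by (simp add: test_function_def box_approx_def[abs_def])
qed

lemma box_approx_bounds: "0 \<le> box_approx m a b x" "box_approx m a b x \<le> 1"
  using box_bump_bounds[of a b x] by (auto simp: box_approx_def power_le_one)

lemma box_approx_tendsto: "(\<lambda>m. box_approx m a b x) \<longlonglongrightarrow> indicator (box a b) x"
proof (cases "x \<in> box a b")
  case True
  then have "(\<lambda>m. (1 - box_bump a b x) ^ m) \<longlonglongrightarrow> 0"
    using box_bump_bounds[of a b x] box_bump_eq_0_iff[of a b x]
    by (intro LIMSEQ_realpow_zero) auto
  from tendsto_diff[OF tendsto_const[of 1] this] True show ?thesis
    by (simp add: box_approx_def)
next
  case False
  then show ?thesis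
    using box_bump_eq_0_iff[of a b x] by (simp add: box_approx_def)
qed

subsection \<open>Strong measurability in \<open>L\<^sup>1\<close>\<close>

text \<open>The Bochner integral is 0 when the difference is not integrable, so this is a
  pseudometric only on integrable functions; hence the hypotheses of the triangle
  inequalities.\<close>

definition L1_dist :: "'w measure \<Rightarrow> ('w \<Rightarrow> real) \<Rightarrow> ('w \<Rightarrow> real) \<Rightarrow> real" where
  "L1_dist M f g = (\<integral>\<omega>. \<bar>f \<omega> - g \<omega>\<bar> \<partial>M)"

lemma L1_dist_nonneg: "0 \<le> L1_dist M f g"
  by (simp add: L1_dist_def)

lemma L1_dist_commute: "L1_dist M f g = L1_dist M g f"
  by (simp add: L1_dist_def abs_minus_commute)

lemma L1_dist_triangle:
  assumes "integrable M f" "integrable M g" "integrable M h"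
  shows "L1_dist M f h \<le> L1_dist M f g + L1_dist M g h"
proof -
  have "L1_dist M f h \<le> (\<integral>\<omega>. \<bar>f \<omega> - g \<omega>\<bar> + \<bar>g \<omega> - h \<omega>\<bar> \<partial>M)"
    unfolding L1_dist_def using assms by (intro integral_mono) auto
  then show ?thesis
    unfolding L1_dist_def using assms by (subst (asm) Bochner_Integration.integral_add) auto
qed

lemma L1_dist_triangle2:
  assumes "integrable M f" "integrable M g" "integrable M h"
  shows "\<bar>L1_dist M f h - L1_dist M g h\<bar> \<le> L1_dist M f g"
  using L1_dist_triangle[of M f g h] L1_dist_triangle[of M g f h] L1_dist_commute[of M f g] assms
  by linarith

lemma L1_dist_cong_AE:
  assumes "AE \<omega> in M. f \<omega> = f' \<omega>" "AE \<omega> in M. g \<omega> = g' \<omega>"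
    "f \<in> borel_measurable M" "g \<in> borel_measurable M" "f' \<in> borel_measurable M" "g' \<in> borel_measurable M"
  shows "L1_dist M f g = L1_dist M f' g'"
  unfolding L1_dist_def by (intro integral_cong_AE) (use assms in auto)

lemma L1_dist_add:
  assumes "integrable M f" "integrable M g" "integrable M f'" "integrable M g'"
  shows "L1_dist M (\<lambda>\<omega>. f \<omega> + g \<omega>) (\<lambda>\<omega>. f' \<omega> + g' \<omega>) \<le> L1_dist M f f' + L1_dist M g g'"
proof -
  have "L1_dist M (\<lambda>\<omega>. f \<omega> + g \<omega>) (\<lambda>\<omega>. f' \<omega> + g' \<omega>)
      \<le> (\<integral>\<omega>. \<bar>f \<omega> - f' \<omega>\<bar> + \<bar>g \<omega> - g' \<omega>\<bar> \<partial>M)"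
    unfolding L1_dist_def using assms by (intro integral_mono) auto
  then show ?thesis
    unfolding L1_dist_def using assms by (subst (asm) Bochner_Integration.integral_add) auto
qed

lemma L1_dist_cmult:
  "L1_dist M (\<lambda>\<omega>. c * f \<omega>) (\<lambda>\<omega>. c * g \<omega>) = \<bar>c\<bar> * L1_dist M f g"
  by (simp add: L1_dist_def abs_mult right_diff_distrib[symmetric])

lemma L1_dist_tendsto_dominated:
  assumes "\<And>n::nat. f n \<in> borel_measurable M" "integrable M g" "integrable M w"
    and "AE \<omega> in M. (\<lambda>n. f n \<omega>) \<longlonglongrightarrow> g \<omega>"
    and "\<And>n. AE \<omega> in M. \<bar>f n \<omega>\<bar> \<le> w \<omega>"
  shows "(\<lambda>n. L1_dist M (f n) g) \<longlonglongrightarrow> 0"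
proof -
  have "(\<lambda>n. \<integral>\<omega>. \<bar>f n \<omega> - g \<omega>\<bar> \<partial>M) \<longlonglongrightarrow> (\<integral>\<omega>. 0 \<partial>M)"
  proof (rule integral_dominated_convergence)
    show "integrable M (\<lambda>\<omega>. w \<omega> + \<bar>g \<omega>\<bar>)"
      using assms by simp
    show "AE \<omega> in M. (\<lambda>n. \<bar>f n \<omega> - g \<omega>\<bar>) \<longlonglongrightarrow> 0"
      using assms(4) by eventually_elim (simp add: LIM_zero tendsto_rabs_zero)
    show "AE \<omega> in M. norm \<bar>f n \<omega> - g \<omega>\<bar> \<le> w \<omega> + \<bar>g \<omega>\<bar>" for n
      using assms(5)[of n] by eventually_elim auto
  qed (use assms in auto)
  then show ?thesis by (simp add: L1_dist_def)
qed

text \<open>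
  Strong measurability of \<open>Z\<close> as a map into \<open>L\<^sup>1(M)\<close>: uniform approximation by measurable maps
  with countably many values. Unlike joint measurability it only depends on the a.s. classes of
  the \<open>Z t\<close>.
\<close>

definition L1_strongly_measurable ::
    "'t measure \<Rightarrow> 'w measure \<Rightarrow> ('t \<Rightarrow> 'w \<Rightarrow> real) \<Rightarrow> bool" where
  "L1_strongly_measurable N M Z \<longleftrightarrow>
     (\<forall>t\<in>space N. integrable M (Z t)) \<and>
     (\<forall>e>0. \<exists>U. \<exists>\<kappa>\<in>measurable N (count_space UNIV).
        (\<forall>k::nat. integrable M (U k)) \<and> (\<forall>t\<in>space N. L1_dist M (Z t) (U (\<kappa> t)) < e))"

lemma L1_strongly_measurableD:
  assumes "L1_strongly_measurable N M Z" "0 < e"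
  obtains U \<kappa> where "\<kappa> \<in> measurable N (count_space UNIV)" "\<And>k::nat. integrable M (U k)"
    "\<And>t. t \<in> space N \<Longrightarrow> L1_dist M (Z t) (U (\<kappa> t)) < e"
  using assms unfolding L1_strongly_measurable_def by meson

lemma L1_strongly_measurable_integrable:
  "L1_strongly_measurable N M Z \<Longrightarrow> t \<in> space N \<Longrightarrow> integrable M (Z t)"
  unfolding L1_strongly_measurable_def by blast

text \<open>The exceptional null set may depend on \<open>t\<close>. This is what makes identities
  between conditional expectations, valid a.s. for each fixed \<open>t\<close>, usable here.\<close>

lemma L1_strongly_measurable_cong_AE:
  assumes Z: "L1_strongly_measurable N M Z"
    and ae: "\<And>t. t \<in> space N \<Longrightarrow> AE \<omega> in M. Z' t \<omega> = Z t \<omega>"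
    and meas: "\<And>t. t \<in> space N \<Longrightarrow> Z' t \<in> borel_measurable M"
  shows "L1_strongly_measurable N M Z'"
  unfolding L1_strongly_measurable_def
proof (intro conjI ballI allI impI)
  fix t assume t: "t \<in> space N"
  show "integrable M (Z' t)"
    by (rule integrable_cong_AE_imp[OF L1_strongly_measurable_integrable[OF Z t] meas[OF t]])
      (rule AE_symmetric[OF ae[OF t]])
next
  fix e :: real assume "0 < e"
  then obtain U \<kappa> where *: "\<kappa> \<in> measurable N (count_space UNIV)" "\<And>k::nat. integrable M (U k)"
    "\<And>t. t \<in> space N \<Longrightarrow> L1_dist M (Z t) (U (\<kappa> t)) < e"
    using L1_strongly_measurableD[OF Z] by metis
  have "L1_dist M (Z' t) (U (\<kappa> t)) < e" if t: "t \<in> space N" for t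
  proof -
    have "L1_dist M (Z' t) (U (\<kappa> t)) = L1_dist M (Z t) (U (\<kappa> t))"
      by (intro L1_dist_cong_AE ae meas t borel_measurable_integrable *(2)
          L1_strongly_measurable_integrable[OF Z]) auto
    then show ?thesis using *(3)[OF t] by simp
  qed
  then show "\<exists>U. \<exists>\<kappa>\<in>measurable N (count_space UNIV).
        (\<forall>k::nat. integrable M (U k)) \<and> (\<forall>t\<in>space N. L1_dist M (Z' t) (U (\<kappa> t)) < e)"
    using * by blast
qed

lemma L1_strongly_measurable_const:
  "integrable M f \<Longrightarrow> L1_strongly_measurable N M (\<lambda>_. f)"
  unfolding L1_strongly_measurable_def
  by (auto intro!: exI[of _ "\<lambda>_. f"] bexI[of _ "\<lambda>_. 0"] simp: L1_dist_def)

text \<open>For a countably-valued approximant the distance to \<open>W\<close> is a function of the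
  Borel index, and these distances converge uniformly by the triangle inequality.\<close>

lemma L1_strongly_measurable_measurable_L1_dist:
  assumes Z: "L1_strongly_measurable N M Z" and W: "integrable M W"
  shows "(\<lambda>t. L1_dist M (Z t) W) \<in> borel_measurable N"
proof -
  have "\<exists>U \<kappa>. \<kappa> \<in> measurable N (count_space UNIV) \<and> (\<forall>k::nat. integrable M (U k)) \<and>
      (\<forall>t\<in>space N. L1_dist M (Z t) (U (\<kappa> t)) < inverse (Suc n))" for n
    using L1_strongly_measurableD[OF Z, of "inverse (Suc n)"] by (metis inverse_positive_iff_positive of_nat_0_less_iff zero_less_Suc)
  then obtain U \<kappa> where \<kappa>: "\<And>n. \<kappa> n \<in> measurable N (count_space UNIV)"
    and U: "\<And>n k::nat. integrable M (U n k)"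
    and d: "\<And>n t. t \<in> space N \<Longrightarrow> L1_dist M (Z t) (U n (\<kappa> n t)) < inverse (Suc n)"
    by metis
  show ?thesis
  proof (rule borel_measurable_LIMSEQ_real)
    show "(\<lambda>t. L1_dist M (U n (\<kappa> n t)) W) \<in> borel_measurable N" for n
      by (rule measurable_compose[OF \<kappa>]) simp
    fix t assume t: "t \<in> space N"
    have "(\<lambda>n. L1_dist M (U n (\<kappa> n t)) W - L1_dist M (Z t) W) \<longlonglongrightarrow> 0"
    proof (rule Lim_null_comparison[OF _ LIMSEQ_inverse_real_of_nat])
      show "\<forall>\<^sub>F n in sequentially. norm (L1_dist M (U n (\<kappa> n t)) W - L1_dist M (Z t) W) \<le> inverse (real (Suc n))"
        using L1_dist_triangle2[OF L1_strongly_measurable_integrable[OF Z t] U W] d[OF t]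
        by (intro always_eventually allI) (metis abs_minus_commute less_imp_le order_trans real_norm_def)
    qed
    then show "(\<lambda>n. L1_dist M (U n (\<kappa> n t)) W) \<longlonglongrightarrow> L1_dist M (Z t) W"
      by (rule LIM_zero_cancel)
  qed
qed

text \<open>A Pettis-type argument: all values of all approximants of the \<open>Z n\<close> form
  one sequence \<open>V\<close> that comes arbitrarily close to every \<open>Y t\<close>. The
  distances from \<open>Y t\<close> to the \<open>V j\<close> are measurable in \<open>t\<close> as
  limits, so the first \<open>j\<close> within \<open>e\<close> is a Borel index.\<close>

lemma L1_strongly_measurable_LIMSEQ:
  assumes Z: "\<And>n::nat. L1_strongly_measurable N M (Z n)"
    and Y: "\<And>t. t \<in> space N \<Longrightarrow> integrable M (Y t)"
    and lim: "\<And>t. t \<in> space N \<Longrightarrow> (\<lambda>n. L1_dist M (Z n t) (Y t)) \<longlonglongrightarrow> 0"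
  shows "L1_strongly_measurable N M Y"
proof -
  note int = L1_strongly_measurable_integrable[OF Z]
  have "\<exists>U \<kappa>. \<kappa> \<in> measurable N (count_space UNIV) \<and> (\<forall>k::nat. integrable M (U k)) \<and>
      (\<forall>t\<in>space N. L1_dist M (Z n t) (U (\<kappa> t)) < inverse (Suc m))" for n m
    using L1_strongly_measurableD[OF Z, of "inverse (Suc m)" n] by (metis inverse_positive_iff_positive of_nat_0_less_iff zero_less_Suc)
  then obtain U \<kappa> where U: "\<And>n m k::nat. integrable M (U n m k)"
    and d: "\<And>n m t. t \<in> space N \<Longrightarrow> L1_dist M (Z n t) (U n m (\<kappa> n m t)) < inverse (Suc m)"
    by metis
  \<comment> \<open>\<open>V\<close> enumerates the triples \<open>(n, (m, k))\<close>: family,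
    precision, value.\<close>
  define V where "V j = (case prod_decode j of (n, l) \<Rightarrow> case prod_decode l of (m, k) \<Rightarrow> U n m k)" for j
  have V: "integrable M (V j)" for j
    by (simp add: V_def U split: prod.split)
  have meas: "(\<lambda>t. L1_dist M (Y t) W) \<in> borel_measurable N" if W: "integrable M W" for W
  proof (rule borel_measurable_LIMSEQ_real)
    show "(\<lambda>t. L1_dist M (Z n t) W) \<in> borel_measurable N" for n
      by (rule L1_strongly_measurable_measurable_L1_dist[OF Z W])
    fix t assume t: "t \<in> space N"
    have "(\<lambda>n. L1_dist M (Z n t) W - L1_dist M (Y t) W) \<longlonglongrightarrow> 0"
      by (rule Lim_null_comparison[OF _ lim[OF t]])
        (simp add: L1_dist_triangle2[OF int[OF t] Y[OF t] W])
    then show "(\<lambda>n. L1_dist M (Z n t) W) \<longlonglongrightarrow> L1_dist M (Y t) W"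
      by (rule LIM_zero_cancel)
  qed
  have dense: "\<exists>j. L1_dist M (Y t) (V j) < e" if t: "t \<in> space N" and e: "0 < e" for t e
  proof -
    obtain n where n: "L1_dist M (Z n t) (Y t) < e / 2"
      using order_tendstoD(2)[OF lim[OF t], of "e / 2"] e by (auto simp: eventually_sequentially)
    obtain m where m: "inverse (Suc m) < e / 2"
      using reals_Archimedean[of "e / 2"] e by auto
    have "L1_dist M (Y t) (U n m (\<kappa> n m t)) \<le> L1_dist M (Y t) (Z n t) + L1_dist M (Z n t) (U n m (\<kappa> n m t))"
      by (rule L1_dist_triangle[OF Y[OF t] int[OF t] U])
    also have "\<dots> < e"
      using n m d[OF t, of n m] by (simp add: L1_dist_commute)
    finally show ?thesis
      by (intro exI[of _ "prod_encode (n, prod_encode (m, \<kappa> n m t))"]) (simp add: V_def)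
  qed
  show ?thesis
    unfolding L1_strongly_measurable_def
  proof (intro conjI ballI allI impI)
    fix e :: real assume e: "0 < e"
    have "(\<lambda>t. LEAST j. L1_dist M (Y t) (V j) < e) \<in> measurable N (count_space UNIV)"
    proof (rule measurable_Least)
      fix j
      note [measurable] = meas[OF V[of j]]
      show "Measurable.pred N (\<lambda>t. L1_dist M (Y t) (V j) < e)" by measurable
    qed
    moreover have "L1_dist M (Y t) (V (LEAST j. L1_dist M (Y t) (V j) < e)) < e" if "t \<in> space N" for t
      using dense[OF that e] by (rule LeastI_ex)
    ultimately show "\<exists>U. \<exists>\<kappa>\<in>measurable N (count_space UNIV).
        (\<forall>k::nat. integrable M (U k)) \<and> (\<forall>t\<in>space N. L1_dist M (Y t) (U (\<kappa> t)) < e)"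
      using V by (intro exI[of _ V] bexI[of _ "\<lambda>t. LEAST j. L1_dist M (Y t) (V j) < e"]) auto
  qed (rule Y)
qed

lemma L1_strongly_measurable_add:
  assumes Z: "L1_strongly_measurable N M Z" and Y: "L1_strongly_measurable N M Y"
  shows "L1_strongly_measurable N M (\<lambda>t \<omega>. Z t \<omega> + Y t \<omega>)"
  unfolding L1_strongly_measurable_def
proof (intro conjI ballI allI impI)
  note int = L1_strongly_measurable_integrable[OF Z] L1_strongly_measurable_integrable[OF Y]
  show "integrable M (\<lambda>\<omega>. Z t \<omega> + Y t \<omega>)" if "t \<in> space N" for t
    using int that by auto
  fix e :: real assume "0 < e"
  then have e: "0 < e / 2" by simp
  obtain U \<kappa> where U: "\<kappa> \<in> measurable N (count_space UNIV)" "\<And>k::nat. integrable M (U k)"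
    "\<And>t. t \<in> space N \<Longrightarrow> L1_dist M (Z t) (U (\<kappa> t)) < e / 2"
    using L1_strongly_measurableD[OF Z e] by metis
  obtain V \<mu> where V: "\<mu> \<in> measurable N (count_space UNIV)" "\<And>k::nat. integrable M (V k)"
    "\<And>t. t \<in> space N \<Longrightarrow> L1_dist M (Y t) (V (\<mu> t)) < e / 2"
    using L1_strongly_measurableD[OF Y e] by metis
  define W where "W j = (\<lambda>\<omega>. U (fst (prod_decode j)) \<omega> + V (snd (prod_decode j)) \<omega>)" for j
  have "(\<lambda>t. prod_encode (\<kappa> t, \<mu> t)) \<in> measurable N (count_space UNIV)"
    by (rule measurable_compose_countable[OF _ U(1)], rule measurable_compose_countable[OF _ V(1)]) simp
  moreover have "L1_dist M (\<lambda>\<omega>. Z t \<omega> + Y t \<omega>) (W (prod_encode (\<kappa> t, \<mu> t))) < e"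
    if t: "t \<in> space N" for t
    using L1_dist_add[OF int(1)[OF t] int(2)[OF t] U(2) V(2), of "\<kappa> t" "\<mu> t"] U(3)[OF t] V(3)[OF t]
    by (simp add: W_def)
  moreover have "integrable M (W j)" for j
    using U(2) V(2) by (simp add: W_def)
  ultimately show "\<exists>U. \<exists>\<kappa>\<in>measurable N (count_space UNIV). (\<forall>k::nat. integrable M (U k)) \<and>
      (\<forall>t\<in>space N. L1_dist M (\<lambda>\<omega>. Z t \<omega> + Y t \<omega>) (U (\<kappa> t)) < e)"
    by (intro exI[of _ W] bexI[of _ "\<lambda>t. prod_encode (\<kappa> t, \<mu> t)"]) auto
qed

lemma L1_strongly_measurable_cmult:
  assumes Z: "L1_strongly_measurable N M Z"
  shows "L1_strongly_measurable N M (\<lambda>t \<omega>. c * Z t \<omega>)"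
  unfolding L1_strongly_measurable_def
proof (intro conjI ballI allI impI)
  show "integrable M (\<lambda>\<omega>. c * Z t \<omega>)" if "t \<in> space N" for t
    using L1_strongly_measurable_integrable[OF Z that] by simp
  fix e :: real assume e: "0 < e"
  \<comment> \<open>The summand 1 covers the case \<open>c = 0\<close>.\<close>
  then have "0 < e / (\<bar>c\<bar> + 1)" by simp
  then obtain U \<kappa> where U: "\<kappa> \<in> measurable N (count_space UNIV)" "\<And>k::nat. integrable M (U k)"
    "\<And>t. t \<in> space N \<Longrightarrow> L1_dist M (Z t) (U (\<kappa> t)) < e / (\<bar>c\<bar> + 1)"
    using L1_strongly_measurableD[OF Z] by metis
  have "L1_dist M (\<lambda>\<omega>. c * Z t \<omega>) (\<lambda>\<omega>. c * U (\<kappa> t) \<omega>) < e" if t: "t \<in> space N" for t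
  proof -
    have "\<bar>c\<bar> * L1_dist M (Z t) (U (\<kappa> t)) \<le> (\<bar>c\<bar> + 1) * L1_dist M (Z t) (U (\<kappa> t))"
      by (intro mult_right_mono L1_dist_nonneg) simp
    also have "\<dots> < e"
      using U(3)[OF t] by (simp add: pos_less_divide_eq mult.commute)
    finally show ?thesis by (simp add: L1_dist_cmult)
  qed
  then show "\<exists>U. \<exists>\<kappa>\<in>measurable N (count_space UNIV). (\<forall>k::nat. integrable M (U k)) \<and>
      (\<forall>t\<in>space N. L1_dist M (\<lambda>\<omega>. c * Z t \<omega>) (U (\<kappa> t)) < e)"
    using U by (intro exI[of _ "\<lambda>k \<omega>. c * U k \<omega>"] bexI[of _ \<kappa>]) auto
qed

lemma L1_strongly_measurable_diff:
  assumes "L1_strongly_measurable N M Z" "L1_strongly_measurable N M Y"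
  shows "L1_strongly_measurable N M (\<lambda>t \<omega>. Z t \<omega> - Y t \<omega>)"
  using L1_strongly_measurable_add[OF assms(1) L1_strongly_measurable_cmult[OF assms(2), of "-1"]]
  by simp

lemma L1_strongly_measurable_sum:
  "finite I \<Longrightarrow> (\<And>i. i \<in> I \<Longrightarrow> L1_strongly_measurable N M (Z i)) \<Longrightarrow>
    L1_strongly_measurable N M (\<lambda>t \<omega>. \<Sum>i\<in>I. Z i t \<omega>)"
  by (induction I rule: finite_induct)
    (auto intro: L1_strongly_measurable_add L1_strongly_measurable_const)

text \<open>Gluing along the Borel partition given by \<open>\<kappa>\<close>: the new index codes
  the piece together with the index used on that piece.\<close>

lemma L1_strongly_measurable_compose_countable:
  assumes Z: "\<And>k::nat. L1_strongly_measurable N M (Z k)"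
    and \<kappa>: "\<kappa> \<in> measurable N (count_space UNIV)"
  shows "L1_strongly_measurable N M (\<lambda>t. Z (\<kappa> t) t)"
  unfolding L1_strongly_measurable_def
proof (intro conjI ballI allI impI)
  show "integrable M (Z (\<kappa> t) t)" if "t \<in> space N" for t
    by (rule L1_strongly_measurable_integrable[OF Z that])
  fix e :: real assume e: "0 < e"
  have "\<exists>U \<mu>. \<mu> \<in> measurable N (count_space UNIV) \<and> (\<forall>j::nat. integrable M (U j)) \<and>
      (\<forall>t\<in>space N. L1_dist M (Z k t) (U (\<mu> t)) < e)" for k
    using L1_strongly_measurableD[OF Z e] by metis
  then obtain U \<mu> where \<mu>: "\<And>k. \<mu> k \<in> measurable N (count_space UNIV)"
    and U: "\<And>k j::nat. integrable M (U k j)"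
    and d: "\<And>k t. t \<in> space N \<Longrightarrow> L1_dist M (Z k t) (U k (\<mu> k t)) < e"
    by metis
  define W where "W j = U (fst (prod_decode j)) (snd (prod_decode j))" for j
  have "(\<lambda>t. prod_encode (\<kappa> t, \<mu> (\<kappa> t) t)) \<in> measurable N (count_space UNIV)"
  proof (rule measurable_compose_countable[OF _ \<kappa>])
    show "(\<lambda>t. prod_encode (k, \<mu> k t)) \<in> measurable N (count_space UNIV)" for k
      by (rule measurable_compose[OF \<mu>]) simp
  qed
  then show "\<exists>U. \<exists>\<kappa>'\<in>measurable N (count_space UNIV). (\<forall>k::nat. integrable M (U k)) \<and>
      (\<forall>t\<in>space N. L1_dist M (Z (\<kappa> t) t) (U (\<kappa>' t)) < e)"
    using U d by (intro exI[of _ W] bexI[of _ "\<lambda>t. prod_encode (\<kappa> t, \<mu> (\<kappa> t) t)"]) (auto simp: W_def)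
qed

text \<open>A \<pi>-\<lambda> argument over measurable rectangles. A rectangle is glued from two
  constant families; disjoint unions are L1-limits of finite sums by dominated convergence, with the
  constant 1 as bound.\<close>

lemma L1_strongly_measurable_indicator:
  fixes N :: "'t measure" and M :: "'w measure"
  assumes "finite_measure M" and A: "A \<in> sets (N \<Otimes>\<^sub>M M)"
  shows "L1_strongly_measurable N M (\<lambda>t \<omega>. indicator A (t, \<omega>))"
proof -
  interpret finite_measure M by fact
  have meas: "(\<lambda>\<omega>. indicator B (t, \<omega>) :: real) \<in> borel_measurable M"
    if "B \<in> sets (N \<Otimes>\<^sub>M M)" "t \<in> space N" for B t
    using that measurable_Pair2[OF borel_measurable_indicator, of B N M t] by simp
  have int: "integrable M (\<lambda>\<omega>. indicator B (t, \<omega>) :: real)"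
    if "B \<in> sets (N \<Otimes>\<^sub>M M)" "t \<in> space N" for B t
    using meas[OF that] by (intro integrable_const_bound[where B = 1]) (auto simp: indicator_def)
  note Int_stable_pair_measure_generator pair_measure_closed
  moreover have "A \<in> sigma_sets (space N \<times> space M) {a \<times> b |a b. a \<in> sets N \<and> b \<in> sets M}"
    using A by (simp add: sets_pair_measure)
  ultimately show ?thesis
  proof (induction rule: sigma_sets_induct_disjoint)
    case (basic A)
    then obtain a b where ab: "A = a \<times> b" "a \<in> sets N" "b \<in> sets M" by blast
    define Z where "Z k t = (if k = 1 then indicator b else (\<lambda>_. 0 :: real))" for k :: nat and t :: 't
    have "L1_strongly_measurable N M (Z k)" for k
      using ab(3) unfolding Z_def
      by (auto intro!: L1_strongly_measurable_const integrable_const_bound[where B = 1] simp: indicator_def)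
    moreover have "(\<lambda>t. if t \<in> a then 1 else 0 :: nat) \<in> measurable N (count_space UNIV)"
      using ab(2) by (intro measurable_If) auto
    ultimately have "L1_strongly_measurable N M (\<lambda>t. Z (if t \<in> a then 1 else 0) t)"
      by (rule L1_strongly_measurable_compose_countable)
    moreover have "(\<lambda>t. Z (if t \<in> a then 1 else 0) t) = (\<lambda>t \<omega>. indicator A (t, \<omega>))"
      by (auto simp: Z_def ab(1) indicator_def fun_eq_iff)
    ultimately show ?case by simp
  next
    case empty
    then show ?case by (simp add: L1_strongly_measurable_const)
  next
    case (compl A)
    have A: "A \<in> sets (N \<Otimes>\<^sub>M M)" using compl.hyps by (simp add: sets_pair_measure)
    have "L1_strongly_measurable N M (\<lambda>t \<omega>. 1 - indicator A (t, \<omega>))"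
      by (intro L1_strongly_measurable_diff L1_strongly_measurable_const compl) simp
    then show ?case
    proof (rule L1_strongly_measurable_cong_AE)
      fix t assume t: "t \<in> space N"
      then show "AE \<omega> in M. indicator (space N \<times> space M - A) (t, \<omega>) = (1 - indicator A (t, \<omega>) :: real)"
        by (intro AE_I2) (auto simp: indicator_def)
      show "(\<lambda>\<omega>. indicator (space N \<times> space M - A) (t, \<omega>) :: real) \<in> borel_measurable M"
        using meas[OF sets.compl_sets[OF A] t] by (simp add: space_pair_measure)
    qed
  next
    case (union F)
    have F: "F i \<in> sets (N \<Otimes>\<^sub>M M)" for i using union.hyps by (auto simp: sets_pair_measure)
    show ?case
    proof (rule L1_strongly_measurable_LIMSEQ)
      show "L1_strongly_measurable N M (\<lambda>t \<omega>. \<Sum>i<n. indicator (F i) (t, \<omega>))" for n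
        by (intro L1_strongly_measurable_sum union) simp
      fix t assume t: "t \<in> space N"
      have eq: "(\<Sum>i<n. indicator (F i) x :: real) = indicator (\<Union>i<n. F i) x" for n x
        using union.hyps(1) by (intro indicator_UN_disjoint[symmetric]) (auto simp: disjoint_family_on_def)
      show "(\<lambda>n. L1_dist M (\<lambda>\<omega>. \<Sum>i<n. indicator (F i) (t, \<omega>)) (\<lambda>\<omega>. indicator (\<Union>i. F i) (t, \<omega>))) \<longlonglongrightarrow> 0"
      proof (rule L1_dist_tendsto_dominated[where w = "\<lambda>_. 1"])
        show "(\<lambda>\<omega>. \<Sum>i<n. indicator (F i) (t, \<omega>) :: real) \<in> borel_measurable M" for n
          by (intro borel_measurable_sum meas F t)
        show "AE \<omega> in M. (\<lambda>n. \<Sum>i<n. indicator (F i) (t, \<omega>) :: real) \<longlonglongrightarrow> indicator (\<Union>i. F i) (t, \<omega>)"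
          unfolding eq by (intro AE_I2 LIMSEQ_indicator_UN)
        show "AE \<omega> in M. \<bar>\<Sum>i<n. indicator (F i) (t, \<omega>) :: real\<bar> \<le> 1" for n
          unfolding eq by (simp add: indicator_def)
      qed (use int F t in auto)
    qed (use int F in auto)
  qed
qed

text \<open>Monotone induction from indicators to nonnegative functions. Integrability of the
  sections has to descend to the building blocks, which holds because each of them is dominated by
  the function it builds.\<close>

lemma L1_strongly_measurable_nonneg:
  assumes M: "finite_measure M" and V: "V \<in> borel_measurable (N \<Otimes>\<^sub>M M)" "\<And>x. 0 \<le> V x"
    and "\<And>t. t \<in> space N \<Longrightarrow> integrable M (\<lambda>\<omega>. V (t, \<omega>))"
  shows "L1_strongly_measurable N M (\<lambda>t \<omega>. V (t, \<omega>))"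
  using V assms(4)
proof (induction rule: borel_measurable_induct_real)
  case (set A)
  then show ?case by (intro L1_strongly_measurable_indicator[OF M])
next
  case (mult u c)
  show ?case
  \<comment> \<open>For \<open>c = 0\<close>, integrability of the sections of the product says
    nothing about \<open>u\<close>.\<close>
  proof (cases "c = 0")
    case True
    then show ?thesis by (simp add: L1_strongly_measurable_const)
  next
    case False
    then have "integrable M (\<lambda>\<omega>. u (t, \<omega>))" if "t \<in> space N" for t
      using mult.prems[OF that] by simp
    then show ?thesis
      by (intro L1_strongly_measurable_cmult mult.IH)
  qed
next
  case (add u v)
  have "integrable M (\<lambda>\<omega>. u (t, \<omega>))" "integrable M (\<lambda>\<omega>. v (t, \<omega>))" if t: "t \<in> space N" for t
    by (rule Bochner_Integration.integrable_bound[OF add.prems[OF t]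
            measurable_Pair2[OF add.hyps(1) t]], simp add: add.hyps)
      (rule Bochner_Integration.integrable_bound[OF add.prems[OF t]
            measurable_Pair2[OF add.hyps(3) t]], simp add: add.hyps)
  then show ?case
    by (intro L1_strongly_measurable_add add.IH) auto
next
  case (seq U)
  have le: "U i (t, \<omega>) \<le> V (t, \<omega>)" if "t \<in> space N" "\<omega> \<in> space M" for i t \<omega>
  proof (rule incseq_le)
    show "incseq (\<lambda>i. U i (t, \<omega>))" using seq.hyps(3) by (auto simp: incseq_def le_fun_def)
    show "(\<lambda>i. U i (t, \<omega>)) \<longlonglongrightarrow> V (t, \<omega>)" using seq.hyps(4) that by (simp add: space_pair_measure)
  qed
  have int: "integrable M (\<lambda>\<omega>. U i (t, \<omega>))" if t: "t \<in> space N" for i t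
    by (rule Bochner_Integration.integrable_bound[OF seq.prems[OF t]
          measurable_Pair2[OF seq.hyps(1) t]])
      (simp add: seq.hyps(2) order_trans[OF le[OF t] abs_ge_self])
  show ?case
  proof (rule L1_strongly_measurable_LIMSEQ)
    show "L1_strongly_measurable N M (\<lambda>t \<omega>. U i (t, \<omega>))" for i
      by (rule seq.IH) (rule int)
    fix t assume t: "t \<in> space N"
    show "(\<lambda>i. L1_dist M (\<lambda>\<omega>. U i (t, \<omega>)) (\<lambda>\<omega>. V (t, \<omega>))) \<longlonglongrightarrow> 0"
    proof (rule L1_dist_tendsto_dominated[where w = "\<lambda>\<omega>. V (t, \<omega>)"])
      show "AE \<omega> in M. (\<lambda>i. U i (t, \<omega>)) \<longlonglongrightarrow> V (t, \<omega>)"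
        using seq.hyps(4) t by (intro AE_I2) (simp add: space_pair_measure)
      show "AE \<omega> in M. \<bar>U i (t, \<omega>)\<bar> \<le> V (t, \<omega>)" for i
        using seq.hyps(2) le[OF t] by (intro AE_I2) simp
    qed (use int seq.prems t in auto)
  qed (rule seq.prems)
qed

lemma L1_strongly_measurable_if_jointly_measurable:
  assumes M: "finite_measure M" and V: "(\<lambda>(t, \<omega>). V t \<omega>) \<in> borel_measurable (N \<Otimes>\<^sub>M M)"
    and int: "\<And>t. t \<in> space N \<Longrightarrow> integrable M (V t)"
  shows "L1_strongly_measurable N M V"
proof -
  have meas: "case_prod V \<in> borel_measurable (N \<Otimes>\<^sub>M M)"
    using V by simp
  have "L1_strongly_measurable N M (\<lambda>t \<omega>. max 0 (case_prod V (t, \<omega>)))"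
    by (rule L1_strongly_measurable_nonneg[OF M, where V = "\<lambda>x. max 0 (case_prod V x)"])
      (use meas in \<open>simp_all add: int split_beta'\<close>)
  moreover have "L1_strongly_measurable N M (\<lambda>t \<omega>. max 0 (- case_prod V (t, \<omega>)))"
    by (rule L1_strongly_measurable_nonneg[OF M, where V = "\<lambda>x. max 0 (- case_prod V x)"])
      (use meas in \<open>simp_all add: int split_beta'\<close>)
  ultimately
  have "L1_strongly_measurable N M (\<lambda>t \<omega>. max 0 (V t \<omega>) - max 0 (- V t \<omega>))"
    using L1_strongly_measurable_diff by fastforce
  moreover have "(\<lambda>t \<omega>. max 0 (V t \<omega>) - max 0 (- V t \<omega>)) = V"
    by (auto simp: fun_eq_iff)
  ultimately show ?thesis by simp
qed

subsection \<open>Adapted versions of strongly measurable families\<close>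

text \<open>If the infimum is attained, a constant sequence will do. Otherwise every element lies
  strictly above it, and points within \<open>inverse (Suc j)\<close> of the infimum eventually get
  below any given element.\<close>

lemma coinitial_sequence:
  fixes B :: "real set"
  assumes "B \<noteq> {}" "bdd_below B"
  obtains s :: "nat \<Rightarrow> real" where "\<And>j. s j \<in> B" "\<And>t. t \<in> B \<Longrightarrow> \<exists>j. s j \<le> t"
proof (cases "Inf B \<in> B")
  case True
  then show ?thesis
    using that[of "\<lambda>_. Inf B"] cInf_lower[OF _ assms(2)] by blast
next
  case False
  have "\<exists>x\<in>B. x < Inf B + inverse (Suc j)" for j
    by (rule cInf_lessD[OF assms(1)]) simp
  then obtain s where s: "\<And>j. s j \<in> B" "\<And>j. s j < Inf B + inverse (Suc j)"
    by metis
  have "\<exists>j. s j \<le> t" if "t \<in> B" for t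
  proof -
    have "Inf B < t"
      using False cInf_lower[OF that assms(2)] that by (cases "Inf B = t") auto
    then obtain j where "inverse (Suc j) < t - Inf B"
      using reals_Archimedean[of "t - Inf B"] by auto
    then have "s j \<le> t" using s(2)[of j] by linarith
    then show ?thesis ..
  qed
  then show ?thesis using that s(1) by blast
qed

text \<open>
  The countably many sample times can be taken in the past: the pieces on which the approximant
  is constant are subdivided so that each of them contains a sample time below all its points.
\<close>

lemma L1_strongly_measurable_past_sampling:
  fixes I :: "real set"
  assumes Z: "L1_strongly_measurable (restrict_space borel I) M Z"
    and I: "I \<noteq> {}" "bdd_below I" and e: "0 < e"
  obtains s \<kappa> where "\<kappa> \<in> measurable (restrict_space borel I) (count_space UNIV)"
    "\<And>k::nat. s k \<in> I" "\<And>t. t \<in> I \<Longrightarrow> s (\<kappa> t) \<le> t"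
    "\<And>t. t \<in> I \<Longrightarrow> L1_dist M (Z (s (\<kappa> t))) (Z t) < e"
proof -
  let ?N = "restrict_space borel I"
  have sp: "space ?N = I" by (simp add: space_restrict_space)
  have "0 < e / 2" using e by simp
  then obtain U \<kappa> where \<kappa>: "\<kappa> \<in> measurable ?N (count_space UNIV)"
    and U: "\<And>k::nat. integrable M (U k)"
    and d: "\<And>t. t \<in> I \<Longrightarrow> L1_dist M (Z t) (U (\<kappa> t)) < e / 2"
    using L1_strongly_measurableD[OF Z] sp by metis
  \<comment> \<open>For each level set of \<open>\<kappa>\<close>, a sequence of times in it that
    gets below each of its points. If level \<open>k\<close> is empty, any point of \<open>I\<close>
    serves, since every sample time must lie in \<open>I\<close>.\<close>
  have "\<exists>s::nat \<Rightarrow> real. (\<forall>j. s j \<in> I) \<and> (\<forall>t\<in>I. \<kappa> t = k \<longrightarrow> (\<forall>j. \<kappa> (s j) = k) \<and> (\<exists>j. s j \<le> t))" for k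
  proof (cases "{t \<in> I. \<kappa> t = k} = {}")
    case True
    obtain a where "a \<in> I" using I(1) by blast
    then show ?thesis
      using True by (intro exI[of _ "\<lambda>_. a"]) blast
  next
    case False
    have "bdd_below {t \<in> I. \<kappa> t = k}"
      using I(2) by (rule bdd_below_mono) auto
    then obtain s where "\<And>j::nat. s j \<in> {t \<in> I. \<kappa> t = k}"
      "\<And>t. t \<in> {t \<in> I. \<kappa> t = k} \<Longrightarrow> \<exists>j. s j \<le> t"
      using coinitial_sequence[OF False] by blast
    then show ?thesis
      by (intro exI[of _ s]) blast
  qed
  then have "\<forall>k. \<exists>s::nat \<Rightarrow> real. (\<forall>j. s j \<in> I) \<and>
      (\<forall>t\<in>I. \<kappa> t = k \<longrightarrow> (\<forall>j. \<kappa> (s j) = k) \<and> (\<exists>j. s j \<le> t))"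
    by blast
  from choice[OF this] obtain s where "\<forall>k. (\<forall>j::nat. s k j \<in> I) \<and>
      (\<forall>t\<in>I. \<kappa> t = k \<longrightarrow> (\<forall>j. \<kappa> (s k j) = k) \<and> (\<exists>j. s k j \<le> t))" ..
  then have s: "\<And>k j. s k j \<in> I"
    "\<And>k j t. t \<in> I \<Longrightarrow> \<kappa> t = k \<Longrightarrow> \<kappa> (s k j) = k" "\<And>k t. t \<in> I \<Longrightarrow> \<kappa> t = k \<Longrightarrow> \<exists>j. s k j \<le> t"
    by blast+
  \<comment> \<open>The index records the level of \<open>t\<close> and the first sample time of
    that level not after \<open>t\<close>.\<close>
  define \<mu> where "\<mu> t = prod_encode (\<kappa> t, LEAST j. s (\<kappa> t) j \<le> t)" for t
  define r where "r k = s (fst (prod_decode k)) (snd (prod_decode k))" for k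
  have r: "r (\<mu> t) = s (\<kappa> t) (LEAST j. s (\<kappa> t) j \<le> t)" for t
    by (simp add: r_def \<mu>_def)
  have id: "(\<lambda>t. t) \<in> measurable ?N borel"
    by (simp add: measurable_restrict_space1)
  have "(\<lambda>t. LEAST j. s k j \<le> t) \<in> measurable ?N (count_space UNIV)" for k
  proof (rule measurable_Least)
    show "Measurable.pred ?N (\<lambda>t. s k j \<le> t)" for j
      using id by measurable
  qed
  then have "(\<lambda>t. prod_encode (k, LEAST j. s k j \<le> t)) \<in> measurable ?N (count_space UNIV)" for k
    by (rule measurable_compose) simp
  then have "\<mu> \<in> measurable ?N (count_space UNIV)"
    unfolding \<mu>_def by (rule measurable_compose_countable[OF _ \<kappa>])
  moreover have "r k \<in> I" for k
    by (simp add: r_def s)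
  moreover have "r (\<mu> t) \<le> t" if "t \<in> I" for t
    unfolding r by (rule LeastI_ex) (rule s(3)[OF that refl])
  moreover have "L1_dist M (Z (r (\<mu> t))) (Z t) < e" if t: "t \<in> I" for t
  proof -
    \<comment> \<open>The sample time and \<open>t\<close> share a level, so both values of
      \<open>Z\<close> are within \<open>e / 2\<close> of the same
      \<open>U (\<kappa> t)\<close>.\<close>
    have "\<kappa> (r (\<mu> t)) = \<kappa> t"
      unfolding r by (rule s(2)[OF t refl])
    moreover have rI: "r (\<mu> t) \<in> I" by (simp add: r_def s)
    ultimately have "L1_dist M (Z (r (\<mu> t))) (U (\<kappa> t)) < e / 2"
      using d by metis
    moreover have "L1_dist M (Z (r (\<mu> t))) (Z t)
        \<le> L1_dist M (Z (r (\<mu> t))) (U (\<kappa> t)) + L1_dist M (U (\<kappa> t)) (Z t)"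
      using rI t U by (intro L1_dist_triangle L1_strongly_measurable_integrable[OF Z]) (auto simp: sp)
    ultimately show ?thesis
      using d[OF t] by (simp add: L1_dist_commute)
  qed
  ultimately show ?thesis by (rule that)
qed

text \<open>By monotone convergence the sum of the \<open>\<bar>f n - g\<bar>\<close> has finite
  integral, so it is finite a.e. and its terms tend to 0.\<close>

lemma AE_tendsto_if_L1_dist_summable:
  assumes int: "\<And>n::nat. integrable M (f n)" "integrable M g"
    and sum: "summable (\<lambda>n. L1_dist M (f n) g)"
  shows "AE \<omega> in M. (\<lambda>n. f n \<omega>) \<longlonglongrightarrow> g \<omega>"
proof -
  note [measurable] = int[THEN borel_measurable_integrable]
  have "(\<integral>\<^sup>+\<omega>. (\<Sum>n. ennreal \<bar>f n \<omega> - g \<omega>\<bar>) \<partial>M) = (\<Sum>n. \<integral>\<^sup>+\<omega>. ennreal \<bar>f n \<omega> - g \<omega>\<bar> \<partial>M)"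
    by (rule nn_integral_suminf) measurable
  also have "(\<lambda>n. \<integral>\<^sup>+\<omega>. ennreal \<bar>f n \<omega> - g \<omega>\<bar> \<partial>M) = (\<lambda>n. ennreal (L1_dist M (f n) g))"
    unfolding L1_dist_def
    by (intro ext nn_integral_eq_integral integrable_abs Bochner_Integration.integrable_diff int) simp
  also have "(\<Sum>n. ennreal (L1_dist M (f n) g)) = ennreal (\<Sum>n. L1_dist M (f n) g)"
    by (rule suminf_ennreal2[OF L1_dist_nonneg sum])
  finally have "(\<integral>\<^sup>+\<omega>. (\<Sum>n. ennreal \<bar>f n \<omega> - g \<omega>\<bar>) \<partial>M) \<noteq> \<infinity>"
    by simp
  then have "AE \<omega> in M. (\<Sum>n. ennreal \<bar>f n \<omega> - g \<omega>\<bar>) \<noteq> \<infinity>"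
    by (rule nn_integral_PInf_AE[rotated]) measurable
  then show ?thesis
  proof eventually_elim
    case (elim \<omega>)
    then have "summable (\<lambda>n. \<bar>f n \<omega> - g \<omega>\<bar>)"
      by (intro summable_suminf_not_top) simp_all
    then have "(\<lambda>n. \<bar>f n \<omega> - g \<omega>\<bar>) \<longlonglongrightarrow> 0" by (rule summable_LIMSEQ_zero)
    then show ?case by (rule LIM_zero_cancel[OF tendsto_rabs_zero_cancel])
  qed
qed

theorem L1_strongly_measurable_adapted_version:
  fixes I :: "real set"
  assumes Z: "L1_strongly_measurable (restrict_space borel I) M Z"
    and I: "I \<noteq> {}" "bdd_below I"
    and F: "\<And>s t. s \<in> I \<Longrightarrow> t \<in> I \<Longrightarrow> s \<le> t \<Longrightarrow> Z s \<in> borel_measurable (F t)"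
  obtains Y where "(\<lambda>(t, \<omega>). Y t \<omega>) \<in> borel_measurable (restrict_space borel I \<Otimes>\<^sub>M M)"
    "\<And>t. t \<in> I \<Longrightarrow> AE \<omega> in M. Y t \<omega> = Z t \<omega>" "\<And>t. t \<in> I \<Longrightarrow> Y t \<in> borel_measurable (F t)"
proof -
  let ?N = "restrict_space borel I"
  have int: "integrable M (Z t)" if "t \<in> I" for t
    using L1_strongly_measurable_integrable[OF Z] that by (simp add: space_restrict_space)
  \<comment> \<open>The tolerance \<open>(1/2)^n\<close> is summable, which turns L1-convergence
    into convergence a.s. for each fixed \<open>t\<close>.\<close>
  have "\<exists>\<kappa> s. \<kappa> \<in> measurable ?N (count_space UNIV) \<and> (\<forall>k::nat. s k \<in> I) \<and>
      (\<forall>t\<in>I. s (\<kappa> t) \<le> t \<and> L1_dist M (Z (s (\<kappa> t))) (Z t) < (1/2)^n)" for n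
    using L1_strongly_measurable_past_sampling[OF Z I, of "(1/2)^n"] by (smt (verit) half_gt_zero_iff zero_less_power)
  then obtain \<kappa> s where \<kappa>: "\<And>n. \<kappa> n \<in> measurable ?N (count_space UNIV)"
    and s: "\<And>n k::nat. s n k \<in> I" "\<And>n t. t \<in> I \<Longrightarrow> s n (\<kappa> n t) \<le> t"
    and d: "\<And>n t. t \<in> I \<Longrightarrow> L1_dist M (Z (s n (\<kappa> n t))) (Z t) < (1/2)^n"
    by metis
  \<comment> \<open>\<open>lim\<close> is taken at every \<open>\<omega>\<close>, also where the
    sequence diverges. It preserves measurability as it stands, so no null set is cut out and
    \<open>Y t\<close> is measurable for \<open>F t\<close> itself.\<close>
  define Y where "Y t \<omega> = lim (\<lambda>n. Z (s n (\<kappa> n t)) \<omega>)" for t \<omega>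
  \<comment> \<open>The sampled process selects one of countably many random variables by a Borel
    index in \<open>t\<close>; this gives joint measurability.\<close>
  have "(\<lambda>x. Z (s n (\<kappa> n (fst x))) (snd x)) \<in> borel_measurable (?N \<Otimes>\<^sub>M M)" for n
  proof (rule measurable_compose_countable[where f = "\<lambda>k x. Z (s n k) (snd x)"])
    show "(\<lambda>x. Z (s n k) (snd x)) \<in> borel_measurable (?N \<Otimes>\<^sub>M M)" for k
      by (rule measurable_compose[OF measurable_snd borel_measurable_integrable[OF int[OF s(1)]]])
    show "(\<lambda>x. \<kappa> n (fst x)) \<in> measurable (?N \<Otimes>\<^sub>M M) (count_space UNIV)"
      by (rule measurable_compose[OF measurable_fst \<kappa>])
  qed
  then have "(\<lambda>(t, \<omega>). Y t \<omega>) \<in> borel_measurable (?N \<Otimes>\<^sub>M M)"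
    unfolding Y_def case_prod_beta by (rule borel_measurable_lim_metric)
  moreover have "AE \<omega> in M. Y t \<omega> = Z t \<omega>" if t: "t \<in> I" for t
  proof -
    have "summable (\<lambda>n. L1_dist M (Z (s n (\<kappa> n t))) (Z t))"
      by (rule summable_comparison_test'[OF summable_geometric[of "1/2::real"], where N = 0])
        (use d[OF t] in \<open>simp_all add: L1_dist_nonneg less_imp_le\<close>)
    from AE_tendsto_if_L1_dist_summable[OF int[OF s(1)] int[OF t] this] show ?thesis
      unfolding Y_def by eventually_elim (rule limI)
  qed
  moreover have "Y t \<in> borel_measurable (F t)" if t: "t \<in> I" for t
    unfolding Y_def by (intro borel_measurable_lim_metric F s t)
  ultimately show ?thesis by (rule that)
qed

subsection \<open>Conditional expectations as a function of the conditioning field\<close>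

text \<open>Conditional expectation is monotone; applied to both signs of \<open>f - g\<close> this
  bounds the difference by the conditional expectation of \<open>\<bar>f - g\<bar>\<close>, whose
  integral is unchanged by conditioning.\<close>

lemma (in sigma_finite_subalgebra) real_cond_exp_L1_contraction:
  assumes "integrable M f" "integrable M g"
  shows "L1_dist M (real_cond_exp M F f) (real_cond_exp M F g) \<le> L1_dist M f g"
proof -
  let ?h = "\<lambda>x. f x - g x"
  have h: "integrable M ?h" "integrable M (\<lambda>x. \<bar>?h x\<bar>)" "integrable M (\<lambda>x. - ?h x)"
    using assms by auto
  have "AE x in M. \<bar>real_cond_exp M F f x - real_cond_exp M F g x\<bar> \<le> real_cond_exp M F (\<lambda>x. \<bar>?h x\<bar>) x"
    using real_cond_exp_diff[OF assms] real_cond_exp_diff[OF assms(2,1)]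
      real_cond_exp_mono[OF AE_I2[OF abs_ge_self] h(1,2)]
      real_cond_exp_mono[OF AE_I2[OF abs_ge_minus_self] h(3,2)]
    by eventually_elim (auto simp: abs_le_iff)
  then have "L1_dist M (real_cond_exp M F f) (real_cond_exp M F g)
      \<le> (\<integral>x. real_cond_exp M F (\<lambda>x. \<bar>?h x\<bar>) x \<partial>M)"
    unfolding L1_dist_def
    by (intro integral_mono_AE integrable_abs Bochner_Integration.integrable_diff
        real_cond_exp_int(1) assms h(2))
  also have "\<dots> = L1_dist M f g"
    unfolding L1_dist_def by (rule real_cond_exp_int(2)[OF h(2)])
  finally show ?thesis .
qed

lemma AE_eq_if_L1_dist_eq_0:
  assumes "integrable M f" "integrable M g" "L1_dist M f g = 0"
  shows "AE \<omega> in M. f \<omega> = g \<omega>"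
proof -
  have "AE \<omega> in M. \<bar>f \<omega> - g \<omega>\<bar> = 0"
    using assms integral_nonneg_eq_0_iff_AE[of M "\<lambda>\<omega>. \<bar>f \<omega> - g \<omega>\<bar>"] by (simp add: L1_dist_def)
  then show ?thesis by simp
qed

text \<open>The range of the conditional expectation is closed in L1: with \<open>E\<close>
  idempotent and contracting, the distance from \<open>E g\<close> to \<open>g\<close> is at most
  twice that from \<open>E (f n)\<close> to \<open>g\<close>. It gives the stochastic derivative a
  representative measurable for the conditioning field.\<close>

lemma (in sigma_finite_subalgebra) real_cond_exp_L1_limit:
  assumes f: "\<And>n. integrable M (f n)" and g: "integrable M g"
    and lim: "(\<lambda>n. L1_dist M (real_cond_exp M F (f n)) g) \<longlonglongrightarrow> 0"
  shows "AE \<omega> in M. real_cond_exp M F g \<omega> = g \<omega>"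
proof (rule AE_eq_if_L1_dist_eq_0)
  let ?E = "real_cond_exp M F"
  have int: "integrable M (?E (f n))" "integrable M (?E (?E (f n)))" "integrable M (?E g)" for n
    by (intro real_cond_exp_int f g)+
  have "L1_dist M (?E g) g \<le> 2 * L1_dist M (?E (f n)) g" for n
  proof -
    have "L1_dist M (?E g) g \<le> L1_dist M (?E g) (?E (?E (f n))) + L1_dist M (?E (?E (f n))) g"
      by (rule L1_dist_triangle[OF int(3,2) g])
    also have "L1_dist M (?E (?E (f n))) g = L1_dist M (?E (f n)) g"
      by (intro L1_dist_cong_AE real_cond_exp_F_meas int(1) borel_measurable_cond_exp
          borel_measurable_integrable[OF int(1)] borel_measurable_integrable[OF int(2)]
          borel_measurable_integrable[OF g]) simp
    finally show ?thesis
      using real_cond_exp_L1_contraction[OF g int(1), of n] by (simp add: L1_dist_commute)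
  qed
  moreover have "(\<lambda>n. 2 * L1_dist M (?E (f n)) g) \<longlonglongrightarrow> 0"
    using tendsto_mult_right_zero[OF lim] by blast
  ultimately have "L1_dist M (?E g) g \<le> 0"
    using LIMSEQ_le_const by blast
  then show "L1_dist M (?E g) g = 0"
    using L1_dist_nonneg[of M "?E g" g] by simp
  show "integrable M (?E g)" by (rule int)
qed (rule g)

section \<open>Functions whose conditional expectations depend strongly measurably on the
  conditioning field\<close>

locale cond_exp_family = finite_measure M
  for M :: "'w measure" and N :: "'t measure" and A :: "'t \<Rightarrow> 'w measure" +
  assumes subalgebra_A: "t \<in> space N \<Longrightarrow> subalgebra M (A t)"
begin

lemma sigma_finite_subalgebra: "t \<in> space N \<Longrightarrow> sigma_finite_subalgebra M (A t)"
  using subalgebra_A by (intro finite_measure_subalgebra_is_sigma_finite)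
    (simp add: finite_measure_subalgebra_def finite_measure_subalgebra_axioms_def finite_measure_axioms)

text \<open>Strong measurability, rather than existence of a jointly measurable version, makes
  closure under L1-limits of \<open>f\<close> immediate from the contraction property.\<close>

abbreviation regular_fun :: "('w \<Rightarrow> real) \<Rightarrow> bool" where
  "regular_fun f \<equiv> L1_strongly_measurable N M (\<lambda>t. real_cond_exp M (A t) f)"

lemma regular_fun_const: "regular_fun (\<lambda>_. c)"
  by (rule L1_strongly_measurable_cong_AE[OF L1_strongly_measurable_const[of M "\<lambda>_. c"]])
    (auto intro!: sigma_finite_subalgebra.real_cond_exp_F_meas[OF sigma_finite_subalgebra]
      intro: borel_measurable_cond_exp2)

lemma regular_fun_cong_AE:
  assumes "regular_fun f" "AE \<omega> in M. g \<omega> = f \<omega>"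
    and "f \<in> borel_measurable M" "g \<in> borel_measurable M"
  shows "regular_fun g"
  by (rule L1_strongly_measurable_cong_AE[OF assms(1)])
    (auto intro!: sigma_finite_subalgebra.real_cond_exp_cong[OF sigma_finite_subalgebra]
      intro: borel_measurable_cond_exp2 assms)

lemma regular_fun_add:
  assumes "regular_fun f" "regular_fun g" "integrable M f" "integrable M g"
  shows "regular_fun (\<lambda>\<omega>. f \<omega> + g \<omega>)"
  by (rule L1_strongly_measurable_cong_AE[OF L1_strongly_measurable_add[OF assms(1,2)]])
    (auto intro!: sigma_finite_subalgebra.real_cond_exp_add[OF sigma_finite_subalgebra]
      intro: borel_measurable_cond_exp2 assms)

lemma regular_fun_cmult:
  fixes c :: real
  assumes "regular_fun f" "integrable M f"
  shows "regular_fun (\<lambda>\<omega>. c * f \<omega>)"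
  by (rule L1_strongly_measurable_cong_AE[OF L1_strongly_measurable_cmult[OF assms(1), of c]])
    (auto intro!: sigma_finite_subalgebra.real_cond_exp_cmult[OF sigma_finite_subalgebra]
      intro: borel_measurable_cond_exp2 assms)

lemma regular_fun_LIMSEQ:
  assumes reg: "\<And>n::nat. regular_fun (f n)" and int: "\<And>n. integrable M (f n)" "integrable M g"
    and lim: "(\<lambda>n. L1_dist M (f n) g) \<longlonglongrightarrow> 0"
  shows "regular_fun g"
proof (rule L1_strongly_measurable_LIMSEQ[OF reg])
  fix t assume t: "t \<in> space N"
  interpret A: sigma_finite_subalgebra M "A t" by (rule sigma_finite_subalgebra[OF t])
  show "integrable M (real_cond_exp M (A t) g)"
    by (intro A.real_cond_exp_int int)
  show "(\<lambda>n. L1_dist M (real_cond_exp M (A t) (f n)) (real_cond_exp M (A t) g)) \<longlonglongrightarrow> 0"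
    by (rule Lim_null_comparison[OF _ lim])
      (simp add: L1_dist_nonneg A.real_cond_exp_L1_contraction int)
qed

text \<open>The sets with regular indicator form a \<lambda>-system: complements by linearity,
  disjoint unions by L1-limits of the partial unions.\<close>

lemma regular_fun_indicator:
  assumes G: "Int_stable G" "sets M = sigma_sets (space M) G"
    and reg: "\<And>B. B \<in> G \<Longrightarrow> regular_fun (indicator B)"
    and B: "B \<in> sets M"
  shows "regular_fun (indicator B)"
proof -
  have int: "integrable M (indicator B :: 'w \<Rightarrow> real)" if "B \<in> sets M" for B
    using that by (intro integrable_real_indicator) (auto simp: less_top[symmetric])
  note G(1)
  moreover have "G \<subseteq> Pow (space M)"
    using G(2) sets.space_closed[of M] by (auto intro: sigma_sets.Basic)
  moreover have "B \<in> sigma_sets (space M) G"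
    using B G(2) by simp
  ultimately show ?thesis
  proof (induction rule: sigma_sets_induct_disjoint)
    case (basic B)
    then show ?case by (rule reg)
  next
    case empty
    have "indicator {} = (\<lambda>_::'w. 0 :: real)" by auto
    then show ?case using regular_fun_const[of 0] by metis
  next
    case (compl B)
    have B: "B \<in> sets M" using compl.hyps G(2) by simp
    have "regular_fun (\<lambda>\<omega>. 1 + (-1) * indicator B \<omega>)"
      by (intro regular_fun_add regular_fun_cmult regular_fun_const compl.IH int B
          integrable_mult_right integrable_const) 
    then show ?case
      by (rule regular_fun_cong_AE) (use B in \<open>auto simp: indicator_def\<close>)
  next
    case (union F)
    have F: "F i \<in> sets M" for i using union.hyps G(2) by auto
    have eq: "(\<Sum>i<n. indicator (F i) x :: real) = indicator (\<Union>i<n. F i) x" for n x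
      using union.hyps(1) by (intro indicator_UN_disjoint[symmetric]) (auto simp: disjoint_family_on_def)
    have "regular_fun (\<lambda>x. \<Sum>i<n. indicator (F i) x)" for n
    proof (induction n)
      case 0
      then show ?case using regular_fun_const by simp
    next
      case (Suc n)
      then show ?case
        using F union.IH int by (auto intro!: regular_fun_add Bochner_Integration.integrable_sum)
    qed
    then have "regular_fun (indicator (\<Union>i<n. F i))" for n
      unfolding eq .
    then show ?case
    proof (rule regular_fun_LIMSEQ)
      show "(\<lambda>n. L1_dist M (indicator (\<Union>i<n. F i)) (indicator (\<Union>i. F i))) \<longlonglongrightarrow> 0"
      proof (rule L1_dist_tendsto_dominated[where w = "\<lambda>_. 1"])
        show "AE \<omega> in M. (\<lambda>n. indicator (\<Union>i<n. F i) \<omega> :: real) \<longlonglongrightarrow> indicator (\<Union>i. F i) \<omega>"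
          by (intro AE_I2 LIMSEQ_indicator_UN)
      qed (use F int in \<open>auto simp: indicator_def\<close>)
    qed (use F int in auto)
  qed
qed

lemma regular_fun_integrable:
  assumes G: "Int_stable G" "sets M = sigma_sets (space M) G"
    and reg: "\<And>B. B \<in> G \<Longrightarrow> regular_fun (indicator B)"
    and f: "integrable M f"
  shows "regular_fun f"
  using f
proof (induction rule: integrable_induct)
  case (base B c)
  have "regular_fun (\<lambda>\<omega>. c * indicator B \<omega>)"
    using base by (intro regular_fun_cmult regular_fun_indicator[OF G reg]) auto
  then show ?case by (simp add: mult.commute)
next
  case (add f g)
  then show ?case by (intro regular_fun_add)
next
  case (lim f s)
  show ?case
  proof (rule regular_fun_LIMSEQ[OF lim.IH])
    show "(\<lambda>n. L1_dist M (s n) f) \<longlonglongrightarrow> 0"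
      by (rule L1_dist_tendsto_dominated[where w = "\<lambda>\<omega>. 2 * \<bar>f \<omega>\<bar>"]) (use lim.hyps in auto)
  qed (use lim.hyps in auto)
qed

text \<open>The conditioned function now varies with \<open>t\<close> as well. Replace
  \<open>F t\<close> by its countably-valued approximant: each single value is covered by
  \<open>reg\<close>, the pieces are glued along \<open>\<kappa> n\<close>, and contraction keeps
  the error below \<open>inverse (Suc n)\<close>.\<close>

lemma L1_strongly_measurable_cond_exp:
  assumes reg: "\<And>f. integrable M f \<Longrightarrow> regular_fun f"
    and F: "L1_strongly_measurable N M F"
  shows "L1_strongly_measurable N M (\<lambda>t. real_cond_exp M (A t) (F t))"
proof -
  have "\<exists>U \<kappa>. \<kappa> \<in> measurable N (count_space UNIV) \<and> (\<forall>k::nat. integrable M (U k)) \<and>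
      (\<forall>t\<in>space N. L1_dist M (F t) (U (\<kappa> t)) < inverse (Suc n))" for n
    using L1_strongly_measurableD[OF F, of "inverse (Suc n)"]
    by (metis inverse_positive_iff_positive of_nat_0_less_iff zero_less_Suc)
  then obtain U \<kappa> where \<kappa>: "\<And>n. \<kappa> n \<in> measurable N (count_space UNIV)"
    and U: "\<And>n k::nat. integrable M (U n k)"
    and d: "\<And>n t. t \<in> space N \<Longrightarrow> L1_dist M (F t) (U n (\<kappa> n t)) < inverse (Suc n)"
    by metis
  have "L1_strongly_measurable N M (\<lambda>t. real_cond_exp M (A t) (U n (\<kappa> n t)))" for n
    by (rule L1_strongly_measurable_compose_countable
        [where Z = "\<lambda>k t. real_cond_exp M (A t) (U n k)", OF reg[OF U] \<kappa>])
  then show ?thesis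
  proof (rule L1_strongly_measurable_LIMSEQ)
    fix t assume t: "t \<in> space N"
    interpret A: sigma_finite_subalgebra M "A t" by (rule sigma_finite_subalgebra[OF t])
    note Ft = L1_strongly_measurable_integrable[OF F t]
    show "integrable M (real_cond_exp M (A t) (F t))"
      by (intro A.real_cond_exp_int Ft)
    have "L1_dist M (real_cond_exp M (A t) (U n (\<kappa> n t))) (real_cond_exp M (A t) (F t)) \<le> inverse (Suc n)" for n
      using A.real_cond_exp_L1_contraction[OF U Ft, of n "\<kappa> n t"] d[OF t, of n]
      by (simp add: L1_dist_commute)
    then show "(\<lambda>n. L1_dist M (real_cond_exp M (A t) (U n (\<kappa> n t))) (real_cond_exp M (A t) (F t))) \<longlonglongrightarrow> 0"
      by (intro Lim_null_comparison[OF _ LIMSEQ_inverse_real_of_nat]) (simp add: L1_dist_nonneg)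
  qed
qed

end

subsection \<open>Cylinder sets\<close>

lemma borel_measurable_box_approx: "box_approx m a b \<in> borel_measurable borel"
  using test_function_box_approx[of m a b] unfolding test_function_def
  by (metis borel_measurable_continuous_onI k_times_cont_differentiable.simps(1))

lemma borel_measurable_vec_lambda:
  assumes "\<And>i. (\<lambda>x. f x i) \<in> borel_measurable M"
  shows "(\<lambda>x. (\<chi> i. f x i) :: real^'d) \<in> borel_measurable M"
  using assms
  by (subst borel_measurable_euclidean_space) (auto simp: Basis_vec_def inner_axis)

lemma borel_measurable_vec_nth: "(\<lambda>x :: real^'d. x $ i) \<in> borel_measurable borel"
  by (intro borel_measurable_continuous_onI linear_continuous_on bounded_linear_vec_nth)

definition cylinder :: "'w measure \<Rightarrow> (real \<Rightarrow> 'w \<Rightarrow> real^'d) \<Rightarrow>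
    nat \<Rightarrow> (nat \<Rightarrow> real) \<Rightarrow> (nat \<Rightarrow> real^'d) \<Rightarrow> (nat \<Rightarrow> real^'d) \<Rightarrow> 'w set" where
  "cylinder M X n \<tau> a b = {\<omega>\<in>space M. \<forall>i\<in>{1..n}. X (\<tau> i) \<omega> \<in> box (a i) (b i)}"

definition cylinders_and_null_sets ::
    "'w measure \<Rightarrow> real \<Rightarrow> (real \<Rightarrow> 'w \<Rightarrow> real^'d) \<Rightarrow> 'w set set" where
  "cylinders_and_null_sets M T X =
     {cylinder M X n \<tau> a b |n \<tau> a b. \<forall>i\<in>{1..n}. \<tau> i \<in> {0..T}} \<union> null_sets M"

lemma cylinder_sets:
  assumes "square_integrable_process M T X" "\<forall>i\<in>{1..n}. \<tau> i \<in> {0..T}"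
  shows "cylinder M X n \<tau> a b \<in> sets M"
proof -
  have [measurable]: "X (\<tau> i) \<in> borel_measurable M" if "i \<in> {1..n}" for i
    using assms that by (auto simp: square_integrable_process_def)
  have [measurable]: "box (a i) (b i) \<in> sets borel" for i by simp
  show ?thesis
    unfolding cylinder_def by measurable
qed

lemma Ball_atLeastAtMost_add:
  fixes n n' :: nat
  shows "(\<forall>i\<in>{1..n + n'}. P i) \<longleftrightarrow> (\<forall>i\<in>{1..n}. P i) \<and> (\<forall>i\<in>{1..n'}. P (i + n))"
proof -
  have "{1..n + n'} = {1..n} \<union> (\<lambda>i. i + n) ` {1..n'}"
    unfolding image_add_atLeastAtMost' by auto
  then show ?thesis by (simp only: ball_Un Set.ball_simps)
qed

text \<open>The conditions of the second cylinder are appended to those of the first, with indices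
  shifted by \<open>n\<close>.\<close>

lemma cylinder_Int:
  "cylinder M X n \<tau> a b \<inter> cylinder M X n' \<tau>' a' b' =
    cylinder M X (n + n') (\<lambda>i. if i \<le> n then \<tau> i else \<tau>' (i - n))
      (\<lambda>i. if i \<le> n then a i else a' (i - n)) (\<lambda>i. if i \<le> n then b i else b' (i - n))"
  (is "_ = cylinder M X _ ?\<tau> ?a ?b")
proof -
  have shift: "(?\<tau> (i + n) = \<tau>' i) \<and> (?a (i + n) = a' i) \<and> (?b (i + n) = b' i)" if "i \<in> {1..n'}" for i
    using that by simp
  have "(\<forall>i\<in>{1..n + n'}. X (?\<tau> i) \<omega> \<in> box (?a i) (?b i)) \<longleftrightarrow>
      (\<forall>i\<in>{1..n}. X (\<tau> i) \<omega> \<in> box (a i) (b i)) \<and> (\<forall>i\<in>{1..n'}. X (\<tau>' i) \<omega> \<in> box (a' i) (b' i))" for \<omega>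
    unfolding Ball_atLeastAtMost_add using shift by (intro arg_cong2[where f = "(\<and>)"] ball_cong) auto
  then show ?thesis by (auto simp: cylinder_def)
qed

text \<open>Null sets are among the generators of \<open>process_sigma_field\<close>; adding them
  preserves stability because a null set meets any measurable set in a null set.\<close>

lemma Int_stable_cylinders_and_null_sets:
  assumes "square_integrable_process M T X"
  shows "Int_stable (cylinders_and_null_sets M T X)"
proof (rule Int_stableI)
  fix A B assume A: "A \<in> cylinders_and_null_sets M T X" and B: "B \<in> cylinders_and_null_sets M T X"
  have sets: "A \<in> sets M" "B \<in> sets M"
    using A B cylinder_sets[OF assms] by (auto simp: cylinders_and_null_sets_def)
  consider "A \<in> null_sets M" | "B \<in> null_sets M"
    | "A \<notin> null_sets M" "B \<notin> null_sets M" by blast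
  then show "A \<inter> B \<in> cylinders_and_null_sets M T X"
  proof cases
    case 1
    then show ?thesis
      using null_set_Int2[OF 1 sets(2)] by (simp add: cylinders_and_null_sets_def)
  next
    case 2
    then show ?thesis
      using null_set_Int1[OF 2 sets(1)] by (simp add: cylinders_and_null_sets_def)
  next
    case 3
    then obtain n \<tau> a b n' \<tau>' a' b'
      where eq: "A = cylinder M X n \<tau> a b" "B = cylinder M X n' \<tau>' a' b'"
        and \<tau>: "\<forall>i\<in>{1..n}. \<tau> i \<in> {0..T}" "\<forall>i\<in>{1..n'}. \<tau>' i \<in> {0..T}"
      using A B unfolding cylinders_and_null_sets_def by blast
    have "\<forall>i\<in>{1..n + n'}. (if i \<le> n then \<tau> i else \<tau>' (i - n)) \<in> {0..T}"
      unfolding Ball_atLeastAtMost_add using \<tau> by auto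
    then show ?thesis
      unfolding eq cylinder_Int cylinders_and_null_sets_def by blast
  qed
qed

text \<open>Open boxes generate the Borel sets, so the cylinders with a single time already make
  every \<open>X t\<close> measurable.\<close>

lemma sigma_sets_cylinders_and_null_sets:
  fixes X :: "real \<Rightarrow> 'w \<Rightarrow> real^'d"
  assumes X: "square_integrable_process M T X" and "sets M = process_sigma_field M T X"
  shows "sets M = sigma_sets (space M) (cylinders_and_null_sets M T X)" (is "_ = sigma_sets _ ?G")
proof (rule antisym)
  have G: "?G \<subseteq> sets M"
    using cylinder_sets[OF X] by (auto simp: cylinders_and_null_sets_def)
  then show "sigma_sets (space M) ?G \<subseteq> sets M"
    by (rule sets.sigma_sets_subset)
  let ?S = "sigma (space M) ?G"
  have G': "?G \<subseteq> Pow (space M)" using G sets.space_closed by blast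
  have sets_S: "sets ?S = sigma_sets (space M) ?G" by (rule sets_measure_of[OF G'])
  have "X t -` B \<inter> space M \<in> sets ?S" if t: "t \<in> {0..T}" and B: "B \<in> sets borel" for t B
  proof -
    have "X t \<in> measurable ?S (sigma UNIV (range (\<lambda>(a, b). box a b)))"
    proof (rule measurable_measure_of)
      fix D assume "D \<in> range (\<lambda>(a, b). box a b :: (real^'d) set)"
      then obtain a b where D: "D = box a b" by auto
      have "X t -` D \<inter> space ?S = cylinder M X 1 (\<lambda>_. t) (\<lambda>_. a) (\<lambda>_. b)"
        by (auto simp: D cylinder_def space_measure_of_conv)
      also have "\<dots> \<in> ?G"
        using t unfolding cylinders_and_null_sets_def by blast
      finally show "X t -` D \<inter> space ?S \<in> sets ?S"
        unfolding sets_S by (rule sigma_sets.Basic)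
    qed auto
    then have "X t \<in> borel_measurable ?S"
      by (simp add: borel_eq_box[symmetric])
    from measurable_sets[OF this B] show ?thesis
      by (simp add: space_measure_of_conv)
  qed
  then show "sets M \<subseteq> sigma_sets (space M) ?G"
    unfolding assms(2) process_sigma_field_def sets_S
    by (intro sigma_sets_mono) (auto simp: cylinders_and_null_sets_def intro: sigma_sets.Basic)
qed

lemma integrable_component:
  fixes X :: "real \<Rightarrow> 'w \<Rightarrow> real^'d"
  assumes "finite_measure M" "square_integrable_process M T X" "t \<in> {0..T}"
  shows "integrable M (\<lambda>\<omega>. X t \<omega> $ i)"
proof (rule Bochner_Integration.integrable_bound)
  interpret finite_measure M by fact
  show "integrable M (\<lambda>\<omega>. 1 + (norm (X t \<omega>))\<^sup>2)"
    using assms(2,3) by (simp add: square_integrable_process_def)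
  show "(\<lambda>\<omega>. X t \<omega> $ i) \<in> borel_measurable M"
    using assms(2,3) by (intro measurable_compose[OF _ borel_measurable_vec_nth])
      (simp add: square_integrable_process_def)
  \<comment> \<open>From \<open>(norm x - 1)\<^sup>2 \<ge> 0\<close>, which bounds
    \<open>norm x\<close> by half of \<open>1 + (norm x)\<^sup>2\<close>.\<close>
  have "\<bar>x $ i\<bar> \<le> 1 + (norm x)\<^sup>2" for x :: "real^'d"
    using component_le_norm_cart[of x i] zero_le_power2[of "norm x - 1"]
    by (auto simp: power2_diff)
  then show "AE \<omega> in M. norm (X t \<omega> $ i) \<le> norm (1 + (norm (X t \<omega>))\<^sup>2)"
    by (intro AE_I2) simp
qed

text \<open>Regularity speaks of products of test functions only. The indicator of a cylinder is a
  bounded limit of such products built from \<open>box_approx\<close>; from the \<pi>-system of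
  cylinders and null sets the property spreads to all integrable functions.\<close>

lemma regular_for_cond_exp_strongly_measurable:
  assumes M: "finite_measure M" and X: "square_integrable_process M T X"
    and sets: "sets M = process_sigma_field M T X"
    and subalg: "\<And>t. t \<in> {0<..<T} \<Longrightarrow> subalgebra M (\<A> t)"
    and reg: "regular_for M T \<A> X"
    and f: "integrable M f"
  shows "L1_strongly_measurable (restrict_space borel {0<..<T}) M (\<lambda>t. real_cond_exp M (\<A> t) f)"
proof -
  let ?N = "restrict_space borel {0<..<T}"
  interpret finite_measure M by fact
  interpret cond_exp_family M ?N \<A>
    by unfold_locales (simp add: subalg space_restrict_space)
  show ?thesis
  proof (rule regular_fun_integrable[OF _ _ _ f])
    show "Int_stable (cylinders_and_null_sets M T X)"
      by (rule Int_stable_cylinders_and_null_sets[OF X])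
    show "Sigma_Algebra.sets M = sigma_sets (space M) (cylinders_and_null_sets M T X)"
      by (rule sigma_sets_cylinders_and_null_sets[OF X sets])
    fix B assume "B \<in> cylinders_and_null_sets M T X"
    then consider "B \<in> null_sets M"
      | n \<tau> a b where "B = cylinder M X n \<tau> a b" "\<forall>i\<in>{1..n}. \<tau> i \<in> {0..T}"
      unfolding cylinders_and_null_sets_def by blast
    then show "regular_fun (indicator B)"
    proof cases
      case 1
      have "AE \<omega> in M. indicator B \<omega> = (0::real)"
        using AE_not_in[OF 1] by eventually_elim simp
      then show ?thesis
        by (rule regular_fun_cong_AE[OF regular_fun_const]) (use 1 in auto)
    next
      case (2 n \<tau> a b)
      define g where "g m \<omega> = (\<Prod>i=1..n. box_approx m (a i) (b i) (X (\<tau> i) \<omega>))" for m \<omega>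
      have g_meas: "g m \<in> borel_measurable M" for m
        unfolding g_def using X 2(2)
        by (intro borel_measurable_prod measurable_compose[OF _ borel_measurable_box_approx])
          (auto simp: square_integrable_process_def)
      have g_le: "\<bar>g m \<omega>\<bar> \<le> 1" for m \<omega>
        unfolding g_def by (auto simp: abs_prod abs_of_nonneg box_approx_bounds intro!: prod_le_1)
      have g_int: "integrable M (g m)" for m
        using g_le by (intro integrable_const_bound[where B = 1] g_meas) auto
      have ind_int: "integrable M (indicator B :: _ \<Rightarrow> real)"
        using cylinder_sets[OF X 2(2)] unfolding 2(1)
        by (intro integrable_real_indicator) (auto simp: less_top[symmetric])
      have g_lim: "(\<lambda>m. g m \<omega>) \<longlonglongrightarrow> indicator B \<omega>" if "\<omega> \<in> space M" for \<omega>
      proof -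
        have "(\<lambda>m. g m \<omega>) \<longlonglongrightarrow> (\<Prod>i=1..n. indicator (box (a i) (b i)) (X (\<tau> i) \<omega>))"
          unfolding g_def by (intro tendsto_prod box_approx_tendsto)
        moreover have "(\<Prod>i=1..n. indicator (box (a i) (b i)) (X (\<tau> i) \<omega>)) = (indicator B \<omega> :: real)"
        proof (cases "\<omega> \<in> B")
          case True
          then show ?thesis by (simp add: 2(1) cylinder_def)
        next
          case False
          then obtain i where i: "i \<in> {1..n}" "X (\<tau> i) \<omega> \<notin> box (a i) (b i)"
            using \<open>\<omega> \<in> space M\<close> unfolding 2(1) cylinder_def by blast
          then have "\<exists>i\<in>{1..n}. indicator (box (a i) (b i)) (X (\<tau> i) \<omega>) = (0::real)"
            by (intro bexI[of _ i]) simp_all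
          then have "(\<Prod>i=1..n. indicator (box (a i) (b i)) (X (\<tau> i) \<omega>)) = (0::real)"
            by (intro prod_zero) simp_all
          then show ?thesis using False by simp
        qed
        ultimately show ?thesis by simp
      qed
      have "regular_fun (g m)" for m
      proof -
        have "\<exists>V :: real \<Rightarrow> _ \<Rightarrow> real. measurable_process M T V \<and>
            (\<forall>t\<in>{0<..<T}. AE \<omega> in M. V t \<omega> = real_cond_exp M (\<A> t) (g m) \<omega>)"
          using reg[unfolded regular_for_def, rule_format, of n \<tau> "\<lambda>i. box_approx m (a i) (b i)"] 2(2)
          by (simp add: g_def[abs_def] test_function_box_approx)
        then obtain V :: "real \<Rightarrow> _ \<Rightarrow> real" where V: "measurable_process M T V"
          "\<And>t. t \<in> {0<..<T} \<Longrightarrow> AE \<omega> in M. V t \<omega> = real_cond_exp M (\<A> t) (g m) \<omega>"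
          by blast
        have V_meas: "V t \<in> borel_measurable M" if "t \<in> {0<..<T}" for t
          using V(1) measurable_Pair2[of "case_prod V" ?N M borel t] that
          by (simp add: measurable_process_def space_restrict_space)
        have "L1_strongly_measurable ?N M V"
        proof (rule L1_strongly_measurable_if_jointly_measurable[OF M])
          show "(\<lambda>(t, \<omega>). V t \<omega>) \<in> borel_measurable (?N \<Otimes>\<^sub>M M)"
            using V(1) by (simp add: measurable_process_def)
          fix t assume "t \<in> space ?N"
          then have t: "t \<in> space ?N" "t \<in> {0<..<T}" by (simp_all add: space_restrict_space)
          show "integrable M (V t)"
            by (rule integrable_cong_AE_imp[OF sigma_finite_subalgebra.real_cond_exp_int(1)
                  [OF sigma_finite_subalgebra[OF t(1)] g_int] V_meas[OF t(2)] AE_symmetric[OF V(2)[OF t(2)]]])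
        qed
        then show ?thesis
          by (rule L1_strongly_measurable_cong_AE[OF _ AE_symmetric[OF V(2)] borel_measurable_cond_exp2])
            (simp add: space_restrict_space)
      qed
      then show ?thesis
      proof (rule regular_fun_LIMSEQ)
        show "(\<lambda>m. L1_dist M (g m) (indicator B)) \<longlonglongrightarrow> 0"
          by (rule L1_dist_tendsto_dominated[where w = "\<lambda>_. 1"])
            (auto intro!: AE_I2 simp: g_lim g_le g_meas ind_int)
      qed (rule g_int ind_int)+
    qed
  qed
qed

subsection \<open>The stochastic derivative\<close>

lemma has_stoch_deriv_component:
  fixes X :: "real \<Rightarrow> 'w \<Rightarrow> real^'d"
  assumes "has_stoch_deriv M T G X t Z"
  shows "((\<lambda>h. L1_dist M (real_cond_exp M G (\<lambda>\<omega>. diff_quot X h t \<omega> $ i)) (\<lambda>\<omega>. Z \<omega> $ i)) \<longlongrightarrow> 0)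
    (at 0 within {h. t + h \<in> {0<..<T}})"
proof -
  have Z: "(\<lambda>\<omega>. Z \<omega> $ i) \<in> borel_measurable M"
    using assms by (intro measurable_compose[OF _ borel_measurable_vec_nth])
      (auto simp: has_stoch_deriv_def)
  let ?D = "\<lambda>h. L1_dist M (real_cond_exp M G (\<lambda>\<omega>. diff_quot X h t \<omega> $ i)) (\<lambda>\<omega>. Z \<omega> $ i)"
  have le: "ennreal (?D h) \<le> (\<integral>\<^sup>+ \<omega>. norm (vec_cond_exp M G (diff_quot X h t) \<omega> - Z \<omega>) \<partial>M)" for h
  proof -
    \<comment> \<open>\<open>enn2real\<close> sends an infinite integral to 0, so the upper bound
      holds whether or not the difference is integrable.\<close>
    have "?D h = enn2real (\<integral>\<^sup>+\<omega>. \<bar>real_cond_exp M G (\<lambda>\<omega>. diff_quot X h t \<omega> $ i) \<omega> - Z \<omega> $ i\<bar> \<partial>M)"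
      unfolding L1_dist_def
      by (rule integral_eq_nn_integral)
        (auto intro!: borel_measurable_abs borel_measurable_diff borel_measurable_cond_exp2 Z)
    then have "ennreal (?D h) \<le> (\<integral>\<^sup>+\<omega>. \<bar>real_cond_exp M G (\<lambda>\<omega>. diff_quot X h t \<omega> $ i) \<omega> - Z \<omega> $ i\<bar> \<partial>M)"
      by (simp add: ennreal_enn2real_if)
    also have "\<dots> \<le> (\<integral>\<^sup>+ \<omega>. norm (vec_cond_exp M G (diff_quot X h t) \<omega> - Z \<omega>) \<partial>M)"
    proof (intro nn_integral_mono ennreal_leI)
      fix \<omega>
      show "\<bar>real_cond_exp M G (\<lambda>\<omega>. diff_quot X h t \<omega> $ i) \<omega> - Z \<omega> $ i\<bar>
          \<le> norm (vec_cond_exp M G (diff_quot X h t) \<omega> - Z \<omega>)"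
        using component_le_norm_cart[of "vec_cond_exp M G (diff_quot X h t) \<omega> - Z \<omega>" i]
        by (simp add: vec_cond_exp_def)
    qed
    finally show ?thesis .
  qed
  have "((\<lambda>h. ennreal (?D h)) \<longlongrightarrow> ennreal 0) (at 0 within {h. t + h \<in> {0<..<T}})"
    unfolding ennreal_0
    by (rule tendsto_sandwich[OF _ _ tendsto_const])
      (use assms le in \<open>auto simp: has_stoch_deriv_def\<close>)
  then show ?thesis
    by (rule tendsto_ennrealD) (simp_all add: L1_dist_nonneg)
qed

lemma integrable_stoch_deriv_component:
  "has_stoch_deriv M T G X t Z \<Longrightarrow> integrable M (\<lambda>\<omega>. Z \<omega> $ i)"
  unfolding has_stoch_deriv_def by (blast intro: integrable_bounded_linear[OF bounded_linear_vec_nth])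

text \<open>
  Near the right end of the interval the increment is not available; there the time is left
  unchanged, so that the quotient vanishes.
\<close>

definition forward_quot ::
    "real \<Rightarrow> (real \<Rightarrow> 'w \<Rightarrow> real^'d) \<Rightarrow> 'd \<Rightarrow> real \<Rightarrow> real \<Rightarrow> 'w \<Rightarrow> real" where
  "forward_quot T X i h t \<omega> = (X (if t + h < T then t + h else t) \<omega> $ i - X t \<omega> $ i) / h"

lemma forward_quot_eq_diff_quot:
  "t + h < T \<Longrightarrow> forward_quot T X i h t = (\<lambda>\<omega>. diff_quot X h t \<omega> $ i)"
  by (simp add: forward_quot_def diff_quot_def fun_eq_iff divide_inverse_commute)

lemma integrable_forward_quot:
  assumes "finite_measure M" "square_integrable_process M T X" "t \<in> {0<..<T}" "0 < h"
  shows "integrable M (forward_quot T X i h t)"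
  unfolding forward_quot_def using assms(3,4)
  by (intro Bochner_Integration.integrable_diff integrable_divide integrable_component[OF assms(1,2)]) auto

lemma jointly_measurable_forward_quot:
  fixes X :: "real \<Rightarrow> 'w \<Rightarrow> real^'d"
  assumes X: "measurable_process M T X" and h: "0 < h"
  shows "(\<lambda>(t, \<omega>). forward_quot T X i h t \<omega>) \<in> borel_measurable (restrict_space borel {0<..<T} \<Otimes>\<^sub>M M)"
proof -
  let ?N = "restrict_space borel {0<..<T}"
  let ?s = "\<lambda>t. if t + h < T then t + h else t"
  \<comment> \<open>The truncated shift maps the open interval into itself, the only region where
    \<open>X\<close> is known to be jointly measurable.\<close>
  have "?s \<in> measurable ?N ?N"
    using h by (intro measurable_restrict_space3) auto
  then have s: "(\<lambda>x. (?s (fst x), snd x)) \<in> measurable (?N \<Otimes>\<^sub>M M) (?N \<Otimes>\<^sub>M M)"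
    by (intro measurable_Pair measurable_compose[OF measurable_fst] measurable_snd)
  have X: "(\<lambda>x. X (fst x) (snd x) $ i) \<in> borel_measurable (?N \<Otimes>\<^sub>M M)"
    using X by (intro measurable_compose[OF _ borel_measurable_vec_nth])
      (simp add: measurable_process_def case_prod_beta)
  from measurable_compose[OF s X] have "(\<lambda>x. X (?s (fst x)) (snd x) $ i) \<in> borel_measurable (?N \<Otimes>\<^sub>M M)"
    by (simp only: fst_conv snd_conv)
  then show ?thesis
    unfolding forward_quot_def case_prod_beta
    by (intro borel_measurable_divide borel_measurable_diff X borel_measurable_const)
qed

lemma stoch_deriv_component_version:
  fixes X :: "real \<Rightarrow> 'w \<Rightarrow> real^'d"
  assumes M: "finite_measure M" and T: "0 < T"
    and X: "square_integrable_process M T X" "measurable_process M T X"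
    and sets: "sets M = process_sigma_field M T X"
    and subalg: "\<And>t. t \<in> {0<..<T} \<Longrightarrow> subalgebra M (\<A> t)"
    and reg: "regular_for M T \<A> X"
    and D: "\<And>t. t \<in> {0<..<T} \<Longrightarrow> has_stoch_deriv M T (\<A> t) X t (D t)"
  obtains Y :: "real \<Rightarrow> 'w \<Rightarrow> real" where "measurable_process M T Y"
    "\<And>t. t \<in> {0<..<T} \<Longrightarrow> AE \<omega> in M. Y t \<omega> = D t \<omega> $ i"
    "\<And>t. t \<in> {0<..<T} \<Longrightarrow> Y t \<in> borel_measurable (generated_filtration M \<A> t)"
proof -
  let ?N = "restrict_space borel {0<..<T}"
  interpret finite_measure M by fact
  interpret cond_exp_family M ?N \<A>
    by unfold_locales (simp add: subalg space_restrict_space)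
  have sp: "space ?N = {0<..<T}" by (simp add: space_restrict_space)
  let ?h = "\<lambda>n. inverse (real (Suc n))"
  let ?F = "\<lambda>n. forward_quot T X i (?h n)"
  \<comment> \<open>\<open>D t\<close> is fixed only up to null sets and need not be measurable for
    \<open>\<A> t\<close>. Conditioning it on \<open>\<A> t\<close> changes it on a null set only
    and yields a representative that is exactly measurable.\<close>
  let ?Z = "\<lambda>t. real_cond_exp M (\<A> t) (\<lambda>\<omega>. D t \<omega> $ i)"
  have F_int: "integrable M (?F n t)" if "t \<in> {0<..<T}" for n t
    by (rule integrable_forward_quot[OF M X(1) that]) simp
  have D_int: "integrable M (\<lambda>\<omega>. D t \<omega> $ i)" if "t \<in> {0<..<T}" for t
    by (rule integrable_stoch_deriv_component[OF D[OF that]])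
  have F_sm: "L1_strongly_measurable ?N M (\<lambda>t. real_cond_exp M (\<A> t) (?F n t))" for n
  proof (rule L1_strongly_measurable_cond_exp)
    show "regular_fun f" if "integrable M f" for f
      by (rule regular_for_cond_exp_strongly_measurable[OF M X(1) sets subalg reg that])
    show "L1_strongly_measurable ?N M (?F n)"
      by (rule L1_strongly_measurable_if_jointly_measurable[OF M jointly_measurable_forward_quot[OF X(2)]])
        (simp, rule F_int, simp add: sp)
  qed
  have lim: "(\<lambda>n. L1_dist M (real_cond_exp M (\<A> t) (?F n t)) (\<lambda>\<omega>. D t \<omega> $ i)) \<longlonglongrightarrow> 0"
    if t: "t \<in> {0<..<T}" for t
  proof -
    have ev: "\<forall>\<^sub>F n in sequentially. t + ?h n < T"
      using order_tendstoD(2)[OF LIMSEQ_inverse_real_of_nat, of "T - t"] t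
      by (auto elim: eventually_mono)
    \<comment> \<open>The increments are nonzero, and \<open>t + ?h n\<close> lies in the interval
      as soon as it is below \<open>T\<close>; there the forward quotient is the true difference
      quotient.\<close>
    have "filterlim ?h (at 0 within {h. t + h \<in> {0<..<T}}) sequentially"
      unfolding filterlim_at
      using ev t LIMSEQ_inverse_real_of_nat
      by (auto elim!: eventually_mono simp del: of_nat_Suc simp: add_pos_pos)
    from filterlim_compose[OF has_stoch_deriv_component[OF D[OF t]] this]
    show ?thesis
      by (rule Lim_transform_eventually)
        (use ev in \<open>auto simp: forward_quot_eq_diff_quot elim!: eventually_mono\<close>)
  qed
  have Z_eq: "AE \<omega> in M. ?Z t \<omega> = D t \<omega> $ i" if t: "t \<in> {0<..<T}" for t
  proof -
    interpret A: sigma_finite_subalgebra M "\<A> t"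
      by (rule sigma_finite_subalgebra) (use t sp in simp)
    show ?thesis
      by (rule A.real_cond_exp_L1_limit[OF F_int[OF t] D_int[OF t] lim[OF t]])
  qed
  have "L1_strongly_measurable ?N M (\<lambda>t \<omega>. D t \<omega> $ i)"
    by (rule L1_strongly_measurable_LIMSEQ[OF F_sm]) (unfold sp, erule D_int, erule lim)
  then have Z_sm: "L1_strongly_measurable ?N M ?Z"
    by (rule L1_strongly_measurable_cong_AE) (simp_all only: sp Z_eq borel_measurable_cond_exp2)
  \<comment> \<open>The sets of \<open>\<A> s\<close> are generators of the filtration at
    \<open>t\<close> whenever \<open>s \<le> t\<close>, so past samples of \<open>?Z\<close> are
    measurable at time \<open>t\<close>.\<close>
  have Z_adapted: "?Z s \<in> borel_measurable (generated_filtration M \<A> t)"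
    if "s \<in> {0<..<T}" "t \<in> {0<..<T}" "s \<le> t" for s t
  proof (rule measurable_from_subalg[OF _ borel_measurable_cond_exp])
    have sub: "(\<Union>s\<in>{0<..t}. Sigma_Algebra.sets (\<A> s)) \<subseteq> Pow (space M)"
      using subalg that(2) sets.sets_into_space by (fastforce simp: subalgebra_def)
    have "Sigma_Algebra.sets (\<A> s) \<subseteq> Sigma_Algebra.sets (generated_filtration M \<A> t)"
      using that by (auto simp: generated_filtration_def sets_measure_of[OF sub] intro!: sigma_sets.Basic)
    then show "subalgebra (generated_filtration M \<A> t) (\<A> s)"
      using subalg[OF that(1)] by (simp add: subalgebra_def generated_filtration_def space_measure_of_conv)
  qed
  obtain Y where Y: "(\<lambda>(t, \<omega>). Y t \<omega>) \<in> borel_measurable (?N \<Otimes>\<^sub>M M)"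
    "\<And>t. t \<in> {0<..<T} \<Longrightarrow> AE \<omega> in M. Y t \<omega> = ?Z t \<omega>"
    "\<And>t. t \<in> {0<..<T} \<Longrightarrow> Y t \<in> borel_measurable (generated_filtration M \<A> t)"
    by (rule L1_strongly_measurable_adapted_version[OF Z_sm _ _ Z_adapted]) (use T in auto)
  have "AE \<omega> in M. Y t \<omega> = D t \<omega> $ i" if t: "t \<in> {0<..<T}" for t
    using Y(2)[OF t] Z_eq[OF t] by eventually_elim simp
  then show ?thesis
    using that[of Y] Y(1,3) by (simp add: measurable_process_def)
qed

theorem theorem3:
  fixes M :: "'w measure"
    and T :: real
    and X :: "real \<Rightarrow> 'w \<Rightarrow> real^'d"
    and \<A> :: "real \<Rightarrow> 'w measure"
  assumes "prob_space M"
    and "complete_measure M"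
    and "0 < T"
    and "square_integrable_process M T X"
    and "measurable_process M T X"
    and "sets M = process_sigma_field M T X"
    and "\<And>t. t \<in> {0<..<T} \<Longrightarrow> subalgebra M (\<A> t)"
    and "regular_for M T \<A> X"
    and "L1_differentiates M T \<A> X"
  shows "\<exists>Y :: real \<Rightarrow> 'w \<Rightarrow> real^'d.
           measurable_process M T Y \<and>
           (\<forall>t\<in>{0<..<T}. AE \<omega> in M. Y t \<omega> = stoch_deriv M T (\<A> t) X t \<omega>) \<and>
           (\<forall>t\<in>{0<..<T}. Y t \<in> borel_measurable (generated_filtration M \<A> t))"
proof -
  let ?D = "\<lambda>t. stoch_deriv M T (\<A> t) X t"
  have M: "finite_measure M"
    using assms(1) by (rule prob_space.finite_measure)
  have D: "has_stoch_deriv M T (\<A> t) X t (?D t)" if "t \<in> {0<..<T}" for t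
  proof -
    have "\<exists>Z. has_stoch_deriv M T (\<A> t) X t Z"
      using assms(9) that by (simp add: L1_differentiates_def L1_differentiates_at_def)
    then show ?thesis
      unfolding stoch_deriv_def by (rule someI_ex)
  qed
  have "\<forall>i. \<exists>Y. measurable_process M T Y \<and>
      (\<forall>t\<in>{0<..<T}. AE \<omega> in M. Y t \<omega> = ?D t \<omega> $ i) \<and>
      (\<forall>t\<in>{0<..<T}. Y t \<in> borel_measurable (generated_filtration M \<A> t))"
    using stoch_deriv_component_version[OF M assms(3-8) D] by metis
  from choice[OF this] obtain Y where Y: "\<And>i. measurable_process M T (Y i)"
    "\<And>i t. t \<in> {0<..<T} \<Longrightarrow> AE \<omega> in M. Y i t \<omega> = ?D t \<omega> $ i"
    "\<And>i t. t \<in> {0<..<T} \<Longrightarrow> Y i t \<in> borel_measurable (generated_filtration M \<A> t)"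
    by blast
  show ?thesis
  proof (intro exI conjI ballI)
    show "measurable_process M T (\<lambda>t \<omega>. \<chi> i. Y i t \<omega>)"
      using Y(1) unfolding measurable_process_def case_prod_beta
      by (rule borel_measurable_vec_lambda)
    fix t assume t: "t \<in> {0<..<T}"
    \<comment> \<open>There are finitely many coordinates, so their exceptional sets unite to a null
      set.\<close>
    have "AE \<omega> in M. \<forall>i. Y i t \<omega> = ?D t \<omega> $ i"
      using AE_finite_allI[OF finite[of UNIV], of "\<lambda>i \<omega>. Y i t \<omega> = ?D t \<omega> $ i"] Y(2)[OF t] by simp
    then show "AE \<omega> in M. (\<chi> i. Y i t \<omega>) = ?D t \<omega>"
      by eventually_elim (simp add: vec_eq_iff)
    show "(\<lambda>\<omega>. \<chi> i. Y i t \<omega>) \<in> borel_measurable (generated_filtration M \<A> t)"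
      by (rule borel_measurable_vec_lambda) (rule Y(3)[OF t])
  qed
qed

end
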